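(* Let $p,Q$ be Hermitian coefficient functions as described in the context and let $K$ be a linear operator on $\mathbb{C}^{2s}$. The boundary condition $$(K-I)\Gamma_1y+i(K+I)\Gamma_2y=0$$ defining $L_K$ is separated if and only if $K$ is block diagonal, i.e. $$K=\begin{pmatrix}K_a&0\\0&K_b\end{pmatrix},$$ where $K_a,K_b$ are arbitrary $s\times s$ matrices. Likewise, the boundary condition $$(K-I)\Gamma_1y-i(K+I)\Gamma_2y=0$$ defining $L^K$ is separated if and only if $K$ is block diagonal of this form.
   Context: Let $s$ be a positive integer and $\mathcal{J}=(a,b)$ a finite interval. $p,Q:\mathcal{J}\to\mathbb{C}^{s\times s}$ are Lebesgue measurable functions whose values are Hermitian matrices, $p$ is invertible almost everywhere, and $$p^{-1},\quad p^{-1}Q,\quad Qp^{-1},\quad Qp^{-1}Q\in L_1(\mathcal{J},\mathbb{C}^{s\times s}).$$ Quasi-derivatives: $$D^{[0]}y=y,\qquad D^{[1]}y=py'-Qy,\qquad D^{[2]}y=(D^{[1]}y)'+Qp^{-1}D^{[1]}y+Qp^{-1}Qy,$$ and $l[y]:=-D^{[2]}y$. Write $L_2=L_2(\mathcal{J},\mathbb{C}^s)$. The maximal operator is $L_{\max}y=l[y]$ with $$\operatorname{Dom}(L_{\max})=\{y\in L_2:\ y,\,D^{[1]}y\in AC([a,b],\mathbb{C}^s),\ D^{[2]}y\in L_2\}$$ ($AC$ = absolutely continuous; $D^{[1]}y$ is identified with its absolutely continuous representative). Define linear maps $\Gamma_1,\Gamma_2:\operatorname{Dom}(L_{\max})\to\mathbb{C}^{2s}=\mathbb{C}^s\oplus\mathbb{C}^s$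 by $$\Gamma_1y=(D^{[1]}y(a),-D^{[1]}y(b)),\qquad \Gamma_2y=(y(a),y(b)).$$ For a linear operator $K$ on $\mathbb{C}^{2s}$ (a $2s\times 2s$ matrix, written in $s\times s$ blocks), $L_K$ is the restriction of $L_{\max}$ to the set of $y\in\operatorname{Dom}(L_{\max})$ satisfying $(K-I)\Gamma_1y+i(K+I)\Gamma_2y=0$, and $L^K$ is the restriction of $L_{\max}$ to the set of $y\in\operatorname{Dom}(L_{\max})$ satisfying $(K-I)\Gamma_1y-i(K+I)\Gamma_2y=0$. For a continuous function $f$ on $[a,b]$ and $c\in[a,b]$, $f_c$ denotes the germ of $f$ at $c$ (two functions have the same germ at $c$ if they coincide on a neighbourhood of $c$ in $[a,b]$). The boundary conditions that define an operator $L\subset L_{\max}$ are called separated if for arbitrary $y\in\operatorname{Dom}(L)$ and any $g,h\in\operatorname{Dom}(L_{\max})$ such that $$g_a=y_a,\quad g_b=0,\quad h_a=0,\quad h_b=y_b,$$ one has $g,h\in\operatorname{Dom}(L)$. *)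

theory Defs
  imports "HOL-Analysis.Analysis"
begin

definition AC_on :: "real \<Rightarrow> real \<Rightarrow> (real \<Rightarrow> 'a::real_normed_vector) \<Rightarrow> bool" where
  "AC_on a b f \<longleftrightarrow>
     (\<forall>\<epsilon>>0. \<exists>\<delta>>0. \<forall>(n::nat) l r.
        (\<forall>i<n. a \<le> l i \<and> l i \<le> r i \<and> r i \<le> b) \<longrightarrow>
        disjoint_family_on (\<lambda>i. {l i<..<r i}) {..<n} \<longrightarrow>
        (\<Sum>i<n. r i - l i) < \<delta> \<longrightarrow>
        (\<Sum>i<n. norm (f (r i) - f (l i))) < \<epsilon>)"

text \<open>Elements of \<open>L\<^sub>2\<close> are represented by functions; only their values on the interval matter.\<close>

definition square_integrable_on :: "real \<Rightarrow> real \<Rightarrow> (real \<Rightarrow> complex^'s) \<Rightarrow> bool" where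
  "square_integrable_on a b f \<longleftrightarrow>
     f \<in> borel_measurable (lebesgue_on {a<..<b}) \<and>
     integrable (lebesgue_on {a<..<b}) (\<lambda>x. (norm (f x))\<^sup>2)"

definition hermitian :: "complex^'s^'s \<Rightarrow> bool" where
  "hermitian A \<longleftrightarrow> map_matrix cnj (transpose A) = A"

text \<open>The first quasi-derivative \<open>p y' - Q y\<close> is only determined almost everywhere; \<open>D1\<close> selects
  an absolutely continuous representative, which, if it exists, is uniquely determined on \<open>[a, b]\<close>
  when \<open>a < b\<close>.\<close>

definition is_D1 :: "real \<Rightarrow> real \<Rightarrow> (real \<Rightarrow> complex^'s^'s) \<Rightarrow> (real \<Rightarrow> complex^'s^'s) \<Rightarrow>
    (real \<Rightarrow> complex^'s) \<Rightarrow> (real \<Rightarrow> complex^'s) \<Rightarrow> bool" where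
  "is_D1 a b p Q y u \<longleftrightarrow> AC_on a b u \<and>
     (AE x in lebesgue_on {a<..<b}. u x = p x *v vector_derivative y (at x) - Q x *v y x)"

definition D1 :: "real \<Rightarrow> real \<Rightarrow> (real \<Rightarrow> complex^'s^'s) \<Rightarrow> (real \<Rightarrow> complex^'s^'s) \<Rightarrow>
    (real \<Rightarrow> complex^'s) \<Rightarrow> (real \<Rightarrow> complex^'s)" where
  "D1 a b p Q y = (SOME u. is_D1 a b p Q y u)"

definition D2 :: "real \<Rightarrow> real \<Rightarrow> (real \<Rightarrow> complex^'s^'s) \<Rightarrow> (real \<Rightarrow> complex^'s^'s) \<Rightarrow>
    (real \<Rightarrow> complex^'s) \<Rightarrow> (real \<Rightarrow> complex^'s)" where
  "D2 a b p Q y = (\<lambda>x. vector_derivative (D1 a b p Q y) (at x)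
     + (Q x ** matrix_inv (p x)) *v D1 a b p Q y x
     + (Q x ** matrix_inv (p x) ** Q x) *v y x)"

definition Dom_max :: "real \<Rightarrow> real \<Rightarrow> (real \<Rightarrow> complex^'s^'s) \<Rightarrow> (real \<Rightarrow> complex^'s^'s) \<Rightarrow>
    (real \<Rightarrow> complex^'s) set" where
  "Dom_max a b p Q = {y. square_integrable_on a b y \<and> AC_on a b y \<and>
     (\<exists>u. is_D1 a b p Q y u) \<and> square_integrable_on a b (D2 a b p Q y)}"

text \<open>Operators are given by their graphs.  An element of the domain is represented by a function
  that is continuous on \<open>[a, b]\<close>.\<close>

definition L_max :: "real \<Rightarrow> real \<Rightarrow> (real \<Rightarrow> complex^'s^'s) \<Rightarrow> (real \<Rightarrow> complex^'s^'s) \<Rightarrow>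
    ((real \<Rightarrow> complex^'s) \<times> (real \<Rightarrow> complex^'s)) set" where
  "L_max a b p Q = {(y, \<lambda>x. - D2 a b p Q y x) | y. y \<in> Dom_max a b p Q}"

definition vec_pair :: "complex^'s \<Rightarrow> complex^'s \<Rightarrow> complex^('s + 's)" where
  "vec_pair u v = (\<chi> i. case i of Inl j \<Rightarrow> u $ j | Inr j \<Rightarrow> v $ j)"

definition \<Gamma>\<^sub>1 :: "real \<Rightarrow> real \<Rightarrow> (real \<Rightarrow> complex^'s^'s) \<Rightarrow> (real \<Rightarrow> complex^'s^'s) \<Rightarrow>
    (real \<Rightarrow> complex^'s) \<Rightarrow> complex^('s + 's)" where
  "\<Gamma>\<^sub>1 a b p Q y = vec_pair (D1 a b p Q y a) (- D1 a b p Q y b)"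

definition \<Gamma>\<^sub>2 :: "real \<Rightarrow> real \<Rightarrow> (real \<Rightarrow> complex^'s) \<Rightarrow> complex^('s + 's)" where
  "\<Gamma>\<^sub>2 a b y = vec_pair (y a) (y b)"

text \<open>The names refer to the position of the index: \<open>L_sub\<close> is $L_K$, \<open>L_sup\<close> is $L^K$.\<close>

definition L_sub :: "real \<Rightarrow> real \<Rightarrow> (real \<Rightarrow> complex^'s^'s) \<Rightarrow> (real \<Rightarrow> complex^'s^'s) \<Rightarrow>
    complex^('s + 's)^('s + 's) \<Rightarrow> ((real \<Rightarrow> complex^'s) \<times> (real \<Rightarrow> complex^'s)) set" where
  "L_sub a b p Q K = {(y, f) \<in> L_max a b p Q.
     (K - mat 1) *v \<Gamma>\<^sub>1 a b p Q y + \<i> *s ((K + mat 1) *v \<Gamma>\<^sub>2 a b y) = 0}"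

definition L_sup :: "real \<Rightarrow> real \<Rightarrow> (real \<Rightarrow> complex^'s^'s) \<Rightarrow> (real \<Rightarrow> complex^'s^'s) \<Rightarrow>
    complex^('s + 's)^('s + 's) \<Rightarrow> ((real \<Rightarrow> complex^'s) \<times> (real \<Rightarrow> complex^'s)) set" where
  "L_sup a b p Q K = {(y, f) \<in> L_max a b p Q.
     (K - mat 1) *v \<Gamma>\<^sub>1 a b p Q y - \<i> *s ((K + mat 1) *v \<Gamma>\<^sub>2 a b y) = 0}"

definition same_germ :: "real \<Rightarrow> real \<Rightarrow> real \<Rightarrow> (real \<Rightarrow> complex^'s) \<Rightarrow> (real \<Rightarrow> complex^'s) \<Rightarrow> bool" where
  "same_germ a b c f g \<longleftrightarrow> (\<exists>U. open U \<and> c \<in> U \<and> (\<forall>x \<in> U \<inter> {a..b}. f x = g x))"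

definition separated :: "real \<Rightarrow> real \<Rightarrow> (real \<Rightarrow> complex^'s^'s) \<Rightarrow> (real \<Rightarrow> complex^'s^'s) \<Rightarrow>
    ((real \<Rightarrow> complex^'s) \<times> (real \<Rightarrow> complex^'s)) set \<Rightarrow> bool" where
  "separated a b p Q L \<longleftrightarrow>
     (\<forall>y \<in> Domain L. \<forall>g \<in> Domain (L_max a b p Q). \<forall>h \<in> Domain (L_max a b p Q).
        same_germ a b a g y \<and> same_germ a b b g (\<lambda>_. 0) \<and>
        same_germ a b a h (\<lambda>_. 0) \<and> same_germ a b b h y \<longrightarrow>
        g \<in> Domain L \<and> h \<in> Domain L)"

definition block_diag :: "complex^'s^'s \<Rightarrow> complex^'s^'s \<Rightarrow> complex^('s + 's)^('s + 's)" where
  "block_diag A B = (\<chi> i j. case (i, j) of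
       (Inl k, Inl l) \<Rightarrow> A $ k $ l
     | (Inr k, Inr l) \<Rightarrow> B $ k $ l
     | _ \<Rightarrow> 0)"

end

theory Submission
  imports Defs
begin

text \<open>
  Both boundary conditions say that the boundary form \<open>(K - I) x\<^sub>1 + \<sigma> (K + I) x\<^sub>2\<close>, with \<open>\<sigma> = \<i>\<close> or
  \<open>\<sigma> = -\<i>\<close>, vanishes at the boundary data \<open>x\<^sub>1 = \<Gamma>\<^sub>1 y\<close>, \<open>x\<^sub>2 = \<Gamma>\<^sub>2 y\<close>.  Two facts reduce the statement to linear algebra.

  The boundary data at an endpoint depend only on the germ there (\<open>same_germ_boundary_values\<close>).
  Conversely, arbitrary boundary data are realised by some \<open>y\<close> in the maximal domain that comes with
  a splitting into \<open>g\<close> and \<open>h\<close> as in the definition of separatedness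
  (\<open>boundary_data_realized\<close>).  Hence separatedness says exactly that the kernel of the boundary form
  is stable under the projection \<open>P\<close> onto the components at \<open>a\<close>, together with the complementary
  projection.  For block diagonal \<open>K\<close> this is clear.  For the converse, the pairs
  \<open>(- \<sigma> (K + I) w, (K - I) w)\<close> lie in the kernel, and applying \<open>P\<close> to both components gives
  \<open>2 \<sigma> (K P - P K) w = 0\<close>; so \<open>K\<close> commutes with \<open>P\<close>, which means that it is block diagonal.

  The analytic content is the realisation of boundary data.  With \<open>u = D\<^sup>[\<^sup>1\<^sup>] y\<close>, the equation
  \<open>D\<^sup>[\<^sup>2\<^sup>] y = f\<close> becomes a first-order linear system for \<open>z = (y, u)\<close> with integrable coefficients and
  forcing \<open>(0, f)\<close>; its solutions with bounded measurable \<open>f\<close> are elements of the maximal domain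
  (\<open>solves_in_Dom_max\<close>).  On a short interval the system is solvable for
  every datum by the contraction principle (\<open>linear_ode_exists\<close>), and any state can be steered to any
  other one by a continuous \<open>f\<close> (\<open>controllable\<close>): if \<open>w\<close> is orthogonal to all states
  reachable from \<open>0\<close>, take the homogeneous solution \<open>v\<close> whose end value is the symplectic dual of
  \<open>w\<close> and use its first component as forcing; the Lagrange identity yields
  \<open>\<integral> \<bar>fst v\<bar>\<^sup>2 = 0\<close>, and since \<open>p\<close> is invertible almost everywhere this forces \<open>v = 0\<close> and \<open>w = 0\<close>.
  Steering the given data at \<open>a\<close> to \<open>0\<close> inside the interval, steering \<open>0\<close> to the given data at \<open>b\<close>,
  and extending by zero gives \<open>g\<close> and \<open>h\<close>, and \<open>y = g + h\<close>.
\<close>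

section \<open>Indefinite integrals\<close>

text \<open>\<open>F\<close> is, on \<open>[a, b]\<close>, an indefinite integral of the Lebesgue integrable function \<open>\<phi>\<close>.  The
  integrals are Henstock--Kurzweil integrals, which agree with the Lebesgue integrals here.\<close>
definition primitive_on :: "real \<Rightarrow> real \<Rightarrow> (real \<Rightarrow> 'a::euclidean_space) \<Rightarrow> (real \<Rightarrow> 'a) \<Rightarrow> bool" where
  "primitive_on a b \<phi> F \<longleftrightarrow>
     \<phi> absolutely_integrable_on {a..b} \<and> (\<forall>t\<in>{a..b}. F t = F a + integral {a..t} \<phi>)"

lemma primitive_on_absolutely_integrable:
  assumes "primitive_on a b \<phi> F"
  shows "\<phi> absolutely_integrable_on {a..b}"
  by (rule assms[unfolded primitive_on_def, THEN conjunct1])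

lemma primitive_on_eq:
  assumes "primitive_on a b \<phi> F" "a \<le> t" "t \<le> b"
  shows "F t = F a + integral {a..t} \<phi>"
  by (rule assms(1)[unfolded primitive_on_def, THEN conjunct2, THEN bspec]) (simp add: assms(2,3))

lemma primitive_on_integrable: "primitive_on a b \<phi> F \<Longrightarrow> \<phi> integrable_on {a..b}"
  by (rule set_lebesgue_integral_eq_integral(1)[OF primitive_on_absolutely_integrable])

text \<open>The defining equation of \<open>primitive_on\<close> loops as a rewrite rule, so it is only used through
  explicit instances.\<close>
lemma primitive_on_diff:
  assumes "primitive_on a b \<phi> F" "a \<le> s" "s \<le> t" "t \<le> b"
  shows "F t - F s = integral {s..t} \<phi>"
proof -
  have "\<phi> integrable_on {a..t}"
    using integrable_subinterval_real[OF primitive_on_integrable[OF assms(1)]] assms(4) by auto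
  then have "integral {a..s} \<phi> + integral {s..t} \<phi> = integral {a..t} \<phi>"
    by (intro Henstock_Kurzweil_Integration.integral_combine) (use assms in auto)
  moreover have "F t = F a + integral {a..t} \<phi>" "F s = F a + integral {a..s} \<phi>"
    using assms by (auto intro!: primitive_on_eq[OF assms(1)])
  ultimately show ?thesis by (simp add: algebra_simps)
qed

lemma primitive_on_subinterval:
  assumes "primitive_on a b \<phi> F" "a \<le> c" "d \<le> b"
  shows "primitive_on c d \<phi> F"
  unfolding primitive_on_def
proof (intro conjI ballI)
  show "\<phi> absolutely_integrable_on {c..d}"
    by (rule absolutely_integrable_on_subinterval[OF primitive_on_absolutely_integrable[OF assms(1)]])
      (use assms in auto)
  fix t assume "t \<in> {c..d}"
  then show "F t = F c + integral {c..t} \<phi>"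
    using primitive_on_diff[OF assms(1), of c t] assms by (simp add: algebra_simps)
qed

lemma primitive_on_continuous:
  assumes "primitive_on a b \<phi> F"
  shows "continuous_on {a..b} F"
proof -
  have "continuous_on {a..b} (\<lambda>t. F a + integral {a..t} \<phi>)"
    by (intro continuous_intros indefinite_integral_continuous_1 primitive_on_integrable[OF assms])
  then show ?thesis
    by (rule continuous_on_eq) (rule primitive_on_eq[OF assms, symmetric], auto)
qed

lemma primitive_on_linear:
  assumes "primitive_on a b \<phi> F" "bounded_linear h"
  shows "primitive_on a b (\<lambda>t. h (\<phi> t)) (\<lambda>t. h (F t))"
  unfolding primitive_on_def
proof (intro conjI ballI)
  interpret h: bounded_linear h by fact
  show "(\<lambda>t. h (\<phi> t)) absolutely_integrable_on {a..b}"
    using absolutely_integrable_linear[OF primitive_on_absolutely_integrable[OF assms(1)] assms(2)]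
    by (simp add: o_def)
  fix t assume t: "t \<in> {a..b}"
  then have "\<phi> integrable_on {a..t}"
    using integrable_subinterval_real[OF primitive_on_integrable[OF assms(1)]] by auto
  then have "integral {a..t} (\<lambda>t. h (\<phi> t)) = h (integral {a..t} \<phi>)"
    using integral_linear[OF _ assms(2), of \<phi> "{a..t}"] by (simp add: o_def)
  then show "h (F t) = h (F a) + integral {a..t} (\<lambda>t. h (\<phi> t))"
    using t primitive_on_eq[OF assms(1), of t] by (simp add: h.add)
qed

lemma primitive_on_add:
  assumes "primitive_on a b \<phi> F" "primitive_on a b \<psi> G"
  shows "primitive_on a b (\<lambda>t. \<phi> t + \<psi> t) (\<lambda>t. F t + G t)"
  unfolding primitive_on_def
proof (intro conjI ballI)
  show "(\<lambda>t. \<phi> t + \<psi> t) absolutely_integrable_on {a..b}"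
    by (rule set_integral_add(1)[OF assms[THEN primitive_on_absolutely_integrable]])
  fix t assume t: "t \<in> {a..b}"
  then have "\<phi> integrable_on {a..t}" "\<psi> integrable_on {a..t}"
    using integrable_subinterval_real[OF primitive_on_integrable[OF assms(1)]]
      integrable_subinterval_real[OF primitive_on_integrable[OF assms(2)]] by auto
  then have "integral {a..t} (\<lambda>t. \<phi> t + \<psi> t) = integral {a..t} \<phi> + integral {a..t} \<psi>"
    by (rule Henstock_Kurzweil_Integration.integral_add)
  moreover have "F t = F a + integral {a..t} \<phi>" "G t = G a + integral {a..t} \<psi>"
    using t by (auto intro!: primitive_on_eq[OF assms(1)] primitive_on_eq[OF assms(2)])
  ultimately show "F t + G t = F a + G a + integral {a..t} (\<lambda>t. \<phi> t + \<psi> t)"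
    by (simp add: algebra_simps)
qed

lemma primitive_on_combine:
  assumes "primitive_on a c \<phi> F" "primitive_on c b \<phi> F" "a \<le> c" "c \<le> b"
  shows "primitive_on a b \<phi> F"
  unfolding primitive_on_def
proof (intro conjI ballI)
  show ai: "\<phi> absolutely_integrable_on {a..b}"
    by (rule absolutely_integrable_on_combine[OF assms(1,2)[THEN primitive_on_absolutely_integrable] assms(3,4)])
  fix t assume t: "t \<in> {a..b}"
  show "F t = F a + integral {a..t} \<phi>"
  proof (cases "t \<le> c")
    case True
    then show ?thesis using primitive_on_eq[OF assms(1), of t] t by simp
  next
    case False
    have "\<phi> integrable_on {a..t}"
      using integrable_subinterval_real[OF set_lebesgue_integral_eq_integral(1)[OF ai]] t by auto
    then have "integral {a..c} \<phi> + integral {c..t} \<phi> = integral {a..t} \<phi>"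
      by (intro Henstock_Kurzweil_Integration.integral_combine) (use assms False in auto)
    moreover have "F t = F c + integral {c..t} \<phi>" "F c = F a + integral {a..c} \<phi>"
      using assms t False by (auto intro!: primitive_on_eq[OF assms(1)] primitive_on_eq[OF assms(2)])
    ultimately show ?thesis by (simp add: algebra_simps)
  qed
qed

lemma primitive_on_spike:
  assumes F: "primitive_on a b \<phi> F" and N: "negligible N"
    and \<psi>: "\<And>t. t \<in> {a..b} - N \<Longrightarrow> \<psi> t = \<phi> t" and G: "\<And>t. t \<in> {a..b} \<Longrightarrow> G t = F t"
  shows "primitive_on a b \<psi> G"
  unfolding primitive_on_def
proof (intro conjI ballI)
  show "\<psi> absolutely_integrable_on {a..b}"
    by (rule absolutely_integrable_spike[OF primitive_on_absolutely_integrable[OF F] N \<psi>])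
  fix t assume t: "t \<in> {a..b}"
  have "integral {a..t} \<phi> = integral {a..t} \<psi>"
    by (rule integral_spike[OF N]) (use \<psi> t in auto)
  then show "G t = G a + integral {a..t} \<psi>"
    using t G[of t] G[of a] primitive_on_eq[OF F, of t] by simp
qed

lemma primitive_on_zero: "primitive_on a b (\<lambda>_. 0) (\<lambda>_. 0)"
  by (simp add: primitive_on_def set_integrable_def)

text \<open>Absolute continuity of the integral, stated for finite families of nonoverlapping intervals as
  in \<open>AC_on\<close>.\<close>
lemma absolutely_integrable_small_sum:
  fixes \<phi> :: "real \<Rightarrow> 'a::euclidean_space"
  assumes "\<phi> absolutely_integrable_on {a..b}" "0 < \<epsilon>"
  shows "\<exists>\<delta>>0. \<forall>(n::nat) l r. (\<forall>i<n. a \<le> l i \<and> l i \<le> r i \<and> r i \<le> b) \<longrightarrow>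
        disjoint_family_on (\<lambda>i. {l i<..<r i}) {..<n} \<longrightarrow> (\<Sum>i<n. r i - l i) < \<delta> \<longrightarrow>
        (\<Sum>i<n. integral {l i..r i} (\<lambda>x. norm (\<phi> x))) < \<epsilon>"
proof -
  define \<psi> where "\<psi> = (\<lambda>x. norm (\<phi> x))"
  have \<psi>: "\<psi> absolutely_integrable_on {a..b}"
    using absolutely_integrable_norm[OF assms(1)] by (simp add: \<psi>_def o_def)
  have \<psi>0: "\<psi> x \<ge> 0" for x by (simp add: \<psi>_def)
  have minint: "(\<lambda>x. min (\<psi> x) (real k)) integrable_on {a..b}" for k
    by (intro set_lebesgue_integral_eq_integral(1) absolutely_integrable_min_1 \<psi>
        absolutely_integrable_continuous_real continuous_intros)
  \<comment> \<open>Split off the part of the integrand exceeding a constant \<open>N\<close>: its integral is small, and the rest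
    is bounded by \<open>N\<close>.\<close>
  define rest where "rest = (\<lambda>k x. \<psi> x - min (\<psi> x) (real k))"
  have restint: "rest k integrable_on {a..b}" for k
    unfolding rest_def
    by (intro Henstock_Kurzweil_Integration.integrable_diff minint set_lebesgue_integral_eq_integral(1) \<psi>)
  have "(\<lambda>k. integral {a..b} (rest k)) \<longlonglongrightarrow> integral {a..b} (\<lambda>x. 0::real)"
  proof (rule dominated_convergence(2)[OF restint])
    show "\<psi> integrable_on {a..b}" by (rule set_lebesgue_integral_eq_integral(1)[OF \<psi>])
    show "norm (rest k x) \<le> \<psi> x" for k x using \<psi>0[of x] by (auto simp: rest_def min_def)
    fix x assume "x \<in> {a..b}"
    have "eventually (\<lambda>k. rest k x = 0) sequentially"
      using eventually_ge_at_top[of "nat \<lceil>\<psi> x\<rceil>"]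
    proof eventually_elim
      case (elim k)
      then have "\<psi> x \<le> real k" by linarith
      then show ?case by (simp add: rest_def)
    qed
    then show "(\<lambda>k. rest k x) \<longlonglongrightarrow> 0" by (rule tendsto_eventually)
  qed
  then have "eventually (\<lambda>k. integral {a..b} (rest k) < \<epsilon>/2) sequentially"
    by (rule order_tendstoD(2)) (use assms in simp)
  then obtain N where N: "integral {a..b} (rest N) < \<epsilon>/2"
    by (auto simp: eventually_sequentially)
  show ?thesis
  proof (intro exI[of _ "\<epsilon> / (2 * (real N + 1))"] conjI allI impI)
    show "0 < \<epsilon> / (2 * (real N + 1))" using assms by simp
    fix n :: nat and l r :: "nat \<Rightarrow> real"
    assume lr': "\<forall>i<n. a \<le> l i \<and> l i \<le> r i \<and> r i \<le> b"
      and disj: "disjoint_family_on (\<lambda>i. {l i<..<r i}) {..<n}"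
      and small: "(\<Sum>i<n. r i - l i) < \<epsilon> / (2 * (real N + 1))"
    have lr: "a \<le> l i \<and> l i \<le> r i \<and> r i \<le> b" if "i < n" for i
      using lr' that by blast
    have sub: "f integrable_on {l i..r i}" if "f integrable_on {a..b}" "i < n" for i and f :: "real \<Rightarrow> real"
      using integrable_subinterval_real[OF that(1)] lr[OF that(2)] by auto
    have un: "(rest N has_integral (\<Sum>i<n. integral {l i..r i} (rest N))) (\<Union>i\<in>{..<n}. {l i..r i})"
    proof (rule has_integral_UN)
      show "pairwise (\<lambda>i i'. negligible ({l i..r i} \<inter> {l i'..r i'})) {..<n}"
      proof (rule pairwiseI)
        fix i j assume "i \<in> {..<n}" "j \<in> {..<n}" "i \<noteq> j"
        then have "{l i<..<r i} \<inter> {l j<..<r j} = {}"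
          using disj by (auto simp: disjoint_family_on_def)
        then have "{l i..r i} \<inter> {l j..r j} \<subseteq> {l i, r i, l j, r j}"
          unfolding set_eq_iff by (simp add: subset_iff) (metis order_le_less)
        then show "negligible ({l i..r i} \<inter> {l j..r j})"
          by (rule negligible_subset[rotated]) simp
      qed
    qed (use sub[OF restint] in auto)
    have "(\<Sum>i<n. integral {l i..r i} (rest N)) = integral (\<Union>i\<in>{..<n}. {l i..r i}) (rest N)"
      using un by (simp add: integral_unique)
    also have "\<dots> \<le> integral {a..b} (rest N)"
    proof (rule integral_subset_le)
      show "(\<Union>i\<in>{..<n}. {l i..r i}) \<subseteq> {a..b}"
        using lr by (intro UN_least) (simp add: subset_iff, meson order_trans)
      show "rest N integrable_on (\<Union>i\<in>{..<n}. {l i..r i})" using un by auto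
    next
      show "rest N integrable_on {a..b}" by (rule restint)
    qed (auto simp: rest_def)
    finally have 1: "(\<Sum>i<n. integral {l i..r i} (rest N)) < \<epsilon>/2" using N by simp
    have 2: "integral {l i..r i} \<psi> \<le> integral {l i..r i} (rest N) + (real N + 1) * (r i - l i)" if i: "i < n" for i
    proof -
      have "integral {l i..r i} \<psi> \<le> integral {l i..r i} (\<lambda>x. rest N x + (real N + 1))"
      proof (rule integral_le)
        show "\<psi> integrable_on {l i..r i}"
          by (rule sub[OF set_lebesgue_integral_eq_integral(1)[OF \<psi>] i])
        show "(\<lambda>x. rest N x + (real N + 1)) integrable_on {l i..r i}"
          by (intro Henstock_Kurzweil_Integration.integrable_add sub[OF restint i]) auto
      qed (auto simp: rest_def)
      also have "\<dots> = integral {l i..r i} (rest N) + integral {l i..r i} (\<lambda>x. real N + 1)"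
        by (intro Henstock_Kurzweil_Integration.integral_add sub[OF restint i]) auto
      finally show ?thesis using lr[OF i] by (simp add: algebra_simps)
    qed
    have "(\<Sum>i<n. integral {l i..r i} \<psi>) \<le> (\<Sum>i<n. integral {l i..r i} (rest N) + (real N + 1) * (r i - l i))"
      by (rule sum_mono) (use 2 in auto)
    also have "\<dots> = (\<Sum>i<n. integral {l i..r i} (rest N)) + (real N + 1) * (\<Sum>i<n. r i - l i)"
      by (simp add: sum.distrib sum_distrib_left)
    also have "\<dots> < \<epsilon>/2 + (real N + 1) * (\<epsilon> / (2 * (real N + 1)))"
      by (rule add_strict_mono[OF 1 mult_strict_left_mono[OF small]]) simp
    also have "\<dots> = \<epsilon>" by (simp add: field_simps)
    finally show "(\<Sum>i<n. integral {l i..r i} (\<lambda>x. norm (\<phi> x))) < \<epsilon>" by (simp add: \<psi>_def)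
  qed
qed

lemma primitive_on_norm_diff_le:
  assumes "primitive_on a b \<phi> F" "a \<le> s" "s \<le> t" "t \<le> b"
  shows "norm (F t - F s) \<le> integral {s..t} (\<lambda>x. norm (\<phi> x))"
proof -
  have ai: "\<phi> absolutely_integrable_on {s..t}"
    by (rule absolutely_integrable_on_subinterval[OF primitive_on_absolutely_integrable[OF assms(1)]])
      (use assms in auto)
  have "norm (integral {s..t} \<phi>) \<le> integral {s..t} (\<lambda>x. norm (\<phi> x))"
    by (rule integral_norm_bound_integral
        [OF set_lebesgue_integral_eq_integral(1)[OF ai]
          ai[unfolded absolutely_integrable_on_def, THEN conjunct2] order_refl])
  then show ?thesis by (simp only: primitive_on_diff[OF assms])
qed

lemma primitive_on_AC_on:
  assumes "primitive_on a b \<phi> F"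
  shows "AC_on a b F"
  unfolding AC_on_def
proof (intro allI impI)
  fix \<epsilon> :: real assume "0 < \<epsilon>"
  from absolutely_integrable_small_sum[OF primitive_on_absolutely_integrable[OF assms] this]
  obtain \<delta> where "0 < \<delta>" and \<delta>: "\<forall>(n::nat) l r. (\<forall>i<n. a \<le> l i \<and> l i \<le> r i \<and> r i \<le> b) \<longrightarrow>
        disjoint_family_on (\<lambda>i. {l i<..<r i}) {..<n} \<longrightarrow> (\<Sum>i<n. r i - l i) < \<delta> \<longrightarrow>
        (\<Sum>i<n. integral {l i..r i} (\<lambda>x. norm (\<phi> x))) < \<epsilon>"
    by (elim exE conjE) (rule that)
  show "\<exists>\<delta>>0. \<forall>(n::nat) l r. (\<forall>i<n. a \<le> l i \<and> l i \<le> r i \<and> r i \<le> b) \<longrightarrow>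
        disjoint_family_on (\<lambda>i. {l i<..<r i}) {..<n} \<longrightarrow>
        (\<Sum>i<n. r i - l i) < \<delta> \<longrightarrow> (\<Sum>i<n. norm (F (r i) - F (l i))) < \<epsilon>"
  proof (intro exI[of _ \<delta>] conjI allI impI)
    fix n :: nat and l r
    assume lr: "\<forall>i<n. a \<le> l i \<and> l i \<le> r i \<and> r i \<le> b"
      and d: "disjoint_family_on (\<lambda>i. {l i<..<r i}) {..<n}" "(\<Sum>i<n. r i - l i) < \<delta>"
    have "(\<Sum>i<n. norm (F (r i) - F (l i))) \<le> (\<Sum>i<n. integral {l i..r i} (\<lambda>x. norm (\<phi> x)))"
      using lr by (intro sum_mono primitive_on_norm_diff_le[OF assms]) auto
    also have "\<dots> < \<epsilon>" by (rule \<delta>[THEN spec, THEN spec, THEN spec, THEN mp, OF lr, THEN mp, OF d(1), THEN mp, OF d(2)])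
    finally show "(\<Sum>i<n. norm (F (r i) - F (l i))) < \<epsilon>" .
  qed fact
qed

lemma AC_on_continuous_on:
  assumes "AC_on a b f"
  shows "continuous_on {a..b} f"
  unfolding continuous_on_iff
proof (intro ballI allI impI)
  fix x e :: real assume x: "x \<in> {a..b}" and "0 < e"
  from assms[unfolded AC_on_def, THEN spec, THEN mp, OF \<open>0 < e\<close>]
  obtain \<delta> where "0 < \<delta>" and \<delta>: "\<forall>(n::nat) l r. (\<forall>i<n. a \<le> l i \<and> l i \<le> r i \<and> r i \<le> b) \<longrightarrow>
        disjoint_family_on (\<lambda>i. {l i<..<r i}) {..<n} \<longrightarrow> (\<Sum>i<n. r i - l i) < \<delta> \<longrightarrow>
        (\<Sum>i<n. norm (f (r i) - f (l i))) < e"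
    by (elim exE conjE) (rule that)
  have close: "norm (f t - f s) < e" if "a \<le> s" "s \<le> t" "t \<le> b" "t - s < \<delta>" for s t
    using \<delta>[THEN spec[of _ 1], THEN spec[of _ "\<lambda>_. s"], THEN spec[of _ "\<lambda>_. t"]] that by (simp add: disjoint_family_on_def)
  show "\<exists>d>0. \<forall>x'\<in>{a..b}. dist x' x < d \<longrightarrow> dist (f x') (f x) < e"
  proof (intro exI[of _ \<delta>] conjI ballI impI)
    fix x' assume x': "x' \<in> {a..b}" "dist x' x < \<delta>"
    show "dist (f x') (f x) < e"
    proof (cases "x \<le> x'")
      case True
      then show ?thesis using close[of x x'] x x' by (simp add: dist_norm)
    next
      case False
      then show ?thesis using close[of x' x] x x' by (simp add: dist_norm norm_minus_commute)
    qed
  qed fact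
qed

lemma absolutely_integrable_on_open_interval:
  fixes f :: "real \<Rightarrow> 'a::euclidean_space"
  assumes "integrable (lebesgue_on {a<..<b}) f"
  shows "f absolutely_integrable_on {a..b}"
proof -
  have "f absolutely_integrable_on {a<..<b}"
    using assms unfolding set_integrable_def by (subst (asm) integrable_restrict_space) auto
  then show ?thesis
  proof (rule absolutely_integrable_spike_set)
    show "negligible {x \<in> {a<..<b} - {a..b}. f x \<noteq> 0}" by (rule negligible_subset[of "{}"]) auto
    show "negligible {x \<in> {a..b} - {a<..<b}. f x \<noteq> 0}" by (rule negligible_subset[of "{a, b}"]) auto
  qed
qed

lemma absolutely_integrable_Pair:
  fixes f :: "real \<Rightarrow> 'a::euclidean_space" and g :: "real \<Rightarrow> 'b::euclidean_space"
  assumes "f absolutely_integrable_on S" "g absolutely_integrable_on S"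
  shows "(\<lambda>t. (f t, g t)) absolutely_integrable_on S"
proof -
  have "bounded_linear (\<lambda>x::'a. (x, 0::'b))" "bounded_linear (\<lambda>x::'b. (0::'a, x))"
    by (intro bounded_linear_Pair bounded_linear_ident bounded_linear_zero)+
  then have "(\<lambda>t. (f t, 0::'b)) absolutely_integrable_on S" "(\<lambda>t. (0::'a, g t)) absolutely_integrable_on S"
    using absolutely_integrable_linear[OF assms(1), of "\<lambda>x. (x, 0)"]
      absolutely_integrable_linear[OF assms(2), of "\<lambda>x. (0, x)"] by (simp_all add: o_def)
  then have "(\<lambda>t. (f t, 0) + (0, g t)) absolutely_integrable_on S" by (rule set_integral_add(1))
  then show ?thesis by simp
qed

section \<open>Differentiation and the product rule for indefinite integrals\<close>

text \<open>Lebesgue's differentiation theorem for indefinite integrals on an interval.\<close>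
lemma primitive_on_AE_has_vector_derivative:
  assumes F: "primitive_on a b \<phi> F"
  shows "AE x in lebesgue_on {a<..<b}. (F has_vector_derivative \<phi> x) (at x)"
proof -
  define \<psi> where "\<psi> = (\<lambda>x. if x \<in> {a..b} then \<phi> x else 0)"
  have "\<psi> absolutely_integrable_on UNIV"
    unfolding \<psi>_def absolutely_integrable_restrict_UNIV
    by (rule primitive_on_absolutely_integrable[OF F])
  then have \<psi>int: "\<psi> integrable_on UNIV" by (rule set_lebesgue_integral_eq_integral(1))
  have int1: "\<psi> integrable_on cbox c d" for c d :: real
    by (rule integrable_on_subcbox[OF \<psi>int]) simp
  have int2: "(\<lambda>x. \<psi> (- x)) integrable_on cbox c d" for c d :: real
    using int1[of "-d" "-c"] integrable_reflect[of \<psi> "-c" "-d"] by simp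
  have One: "One = (1::real)" by (simp add: Basis_real_def)
  \<comment> \<open>The right derivative exists almost everywhere; the left one is the right one of the reflected
    function.\<close>
  obtain N1 where N1: "negligible N1" "\<And>x e. \<lbrakk>x \<notin> N1; 0 < e\<rbrakk> \<Longrightarrow>
      \<exists>d>0. \<forall>h. 0 < h \<and> h < d \<longrightarrow> norm (integral {x..x + h} \<psi> /\<^sub>R h - \<psi> x) < e"
    using integrable_ccontinuous_explicit[OF int1] unfolding One by (auto simp: power_one_right)
  obtain N2 where N2: "negligible N2" "\<And>x e. \<lbrakk>x \<notin> N2; 0 < e\<rbrakk> \<Longrightarrow>
      \<exists>d>0. \<forall>h. 0 < h \<and> h < d \<longrightarrow> norm (integral {x..x + h} (\<lambda>x. \<psi> (- x)) /\<^sub>R h - \<psi> (- x)) < e"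
    using integrable_ccontinuous_explicit[OF int2] unfolding One by (auto simp: power_one_right)
  have neg: "negligible (N1 \<union> uminus ` N2)"
    by (intro negligible_Un N1 negligible_differentiable_image_negligible N2) (auto intro!: derivative_intros)
  have intF: "integral {s..t} \<psi> = F t - F s" if "a \<le> s" "s \<le> t" "t \<le> b" for s t
  proof -
    have "integral {s..t} \<psi> = integral {s..t} \<phi>"
      by (rule integral_cong) (use that in \<open>auto simp: \<psi>_def\<close>)
    then show ?thesis using primitive_on_diff[OF F that] by simp
  qed
  have main: "(F has_vector_derivative \<phi> x) (at x)"
    if x: "x \<in> {a<..<b}" "x \<notin> N1 \<union> uminus ` N2" for x
    unfolding has_vector_derivative_def has_derivative_at_alt
  proof (intro conjI allI impI)
    show "bounded_linear (\<lambda>h. h *\<^sub>R \<phi> x)" by (rule bounded_linear_scaleR_left)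
    fix e :: real assume e: "0 < e"
    have \<psi>x: "\<psi> x = \<phi> x" using x by (simp add: \<psi>_def)
    obtain d1 where d1: "d1 > 0" "\<And>h. 0 < h \<Longrightarrow> h < d1 \<Longrightarrow> norm (integral {x..x + h} \<psi> /\<^sub>R h - \<phi> x) < e"
      using N1(2)[of x e] x e \<psi>x by auto
    have "- x \<notin> N2" using x by force
    then obtain d2 where d2: "d2 > 0"
      "\<And>h. 0 < h \<Longrightarrow> h < d2 \<Longrightarrow> norm (integral {- x..- x + h} (\<lambda>x. \<psi> (- x)) /\<^sub>R h - \<phi> x) < e"
      using N2(2)[of "- x" e] x e \<psi>x by auto
    show "\<exists>d>0. \<forall>y. norm (y - x) < d \<longrightarrow> norm (F y - F x - (y - x) *\<^sub>R \<phi> x) \<le> e * norm (y - x)"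
    proof (intro exI[of _ "min (min d1 d2) (min (x - a) (b - x))"] conjI allI impI)
      show "0 < min (min d1 d2) (min (x - a) (b - x))" using d1 d2 x by auto
      fix y assume "norm (y - x) < min (min d1 d2) (min (x - a) (b - x))"
      then have y: "\<bar>y - x\<bar> < d1" "\<bar>y - x\<bar> < d2" "\<bar>y - x\<bar> < x - a" "\<bar>y - x\<bar> < b - x" by auto
      have scale: "norm (v - h *\<^sub>R \<phi> x) \<le> e * h" if "norm (v /\<^sub>R h - \<phi> x) < e" "0 < h" for v h
      proof -
        have "v - h *\<^sub>R \<phi> x = h *\<^sub>R (v /\<^sub>R h - \<phi> x)"
          using that by (simp add: scaleR_diff_right)
        then have "norm (v - h *\<^sub>R \<phi> x) = h * norm (v /\<^sub>R h - \<phi> x)"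
          using that by simp
        also have "\<dots> \<le> h * e" using that by (intro mult_left_mono) auto
        finally show ?thesis by (simp add: mult.commute)
      qed
      consider "y = x" | "x < y" | "y < x" by linarith
      then show "norm (F y - F x - (y - x) *\<^sub>R \<phi> x) \<le> e * norm (y - x)"
      proof cases
        case 2
        have "integral {x..x + (y - x)} \<psi> = F y - F x" using intF[of x y] 2 x y by simp
        then show ?thesis
          using scale[where v="F y - F x" and h="y - x"] d1(2)[of "y - x"] 2 y by simp
      next
        case 3
        have "integral {- x..- x + (x - y)} (\<lambda>x. \<psi> (- x)) = integral {y..x} \<psi>"
          using integral_reflect_real[of x y \<psi>] by simp
        also have "\<dots> = F x - F y" using intF[of y x] 3 x y by simp
        finally have "norm (F x - F y - (x - y) *\<^sub>R \<phi> x) \<le> e * (x - y)"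
          using scale[where v="F x - F y" and h="x - y"] d2(2)[of "x - y"] 3 y by simp
        moreover have "F y - F x - (y - x) *\<^sub>R \<phi> x = - (F x - F y - (x - y) *\<^sub>R \<phi> x)"
          by (simp add: algebra_simps)
        ultimately show ?thesis using 3 by (simp only: norm_minus_cancel) simp
      qed simp
    qed
  qed
  have "AE x in lebesgue. x \<in> {a<..<b} \<longrightarrow> (F has_vector_derivative \<phi> x) (at x)"
    by (rule AE_I'[OF neg[unfolded negligible_iff_null_sets]]) (use main in blast)
  then show ?thesis by (subst AE_restrict_space_iff) auto
qed

text \<open>The difference \<open>D\<close> of the two sides, as a function of the upper endpoint, has increments of second
  order with respect to \<open>\<integral> (\<bar>f\<bar> + \<bar>g\<bar>)\<close>, and therefore vanishes: no differentiation is needed.\<close>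
lemma primitive_on_product_rule:
  fixes B :: "'a::euclidean_space \<Rightarrow> 'b::euclidean_space \<Rightarrow> 'c::euclidean_space"
  assumes B: "bounded_bilinear B" and F: "primitive_on a b f F" and G: "primitive_on a b g G"
    and "a \<le> b"
  shows "B (F b) (G b) - B (F a) (G a) = integral {a..b} (\<lambda>t. B (F t) (g t) + B (f t) (G t))"
proof -
  interpret B: bounded_bilinear B by fact
  obtain K where K: "K > 0" "\<And>x y. norm (B x y) \<le> norm x * norm y * K"
    using B.pos_bounded by blast
  note fai = primitive_on_absolutely_integrable[OF F] and gai = primitive_on_absolutely_integrable[OF G]
  have meas: "continuous_on {a..b} H \<Longrightarrow> H \<in> borel_measurable (lebesgue_on {a..b})"
    and bdd: "continuous_on {a..b} H \<Longrightarrow> bounded (H ` {a..b})" for H :: "real \<Rightarrow> 'd::euclidean_space"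
    by (auto intro: continuous_imp_measurable_on_sets_lebesgue compact_imp_bounded compact_continuous_image)
  have blin: "bilinear B" "bilinear (\<lambda>y x. B x y)"
    by (simp_all add: bilinear_conv_bounded_bilinear B B.flip)
  have 1: "(\<lambda>t. B (F t) (g t)) absolutely_integrable_on {a..b}"
    using primitive_on_continuous[OF F]
    by (intro absolutely_integrable_bounded_measurable_product[OF blin(1)] gai meas bdd) auto
  have 2: "(\<lambda>t. B (f t) (G t)) absolutely_integrable_on {a..b}"
    using primitive_on_continuous[OF G]
    by (intro absolutely_integrable_bounded_measurable_product[OF blin(2)] fai meas bdd) auto
  define k where "k = (\<lambda>t. B (F t) (g t) + B (f t) (G t))"
  have kint: "k integrable_on {a..b}"
    unfolding k_def by (intro Henstock_Kurzweil_Integration.integrable_add set_lebesgue_integral_eq_integral(1) 1 2)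
  define m where "m = (\<lambda>t. norm (f t) + norm (g t))"
  have mint: "m integrable_on {a..b}"
    using fai gai unfolding m_def absolutely_integrable_on_def
    by (intro Henstock_Kurzweil_Integration.integrable_add) auto
  have sub: "h integrable_on {s..t}" if "h integrable_on {a..b}" "a \<le> s" "t \<le> b"
    for h :: "real \<Rightarrow> 'e::euclidean_space" and s t
    using integrable_subinterval_real[OF that(1)] that(2,3) by auto
  define D where "D = (\<lambda>t. B (F t) (G t) - integral {a..t} k)"
  have step: "norm (D t - D s) \<le> K * e * integral {s..t} m"
    if st: "a \<le> s" "s \<le> t" "t \<le> b"
      and Fe: "\<And>x. x \<in> {s..t} \<Longrightarrow> norm (F s - F x) \<le> e"
      and Ge: "\<And>x. x \<in> {s..t} \<Longrightarrow> norm (G t - G x) \<le> e" for s t e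
  proof -
    have fint: "f integrable_on {s..t}" and gint: "g integrable_on {s..t}"
      using sub[OF primitive_on_integrable[OF F]] sub[OF primitive_on_integrable[OF G]] st by auto
    have "D t - D s = B (F t - F s) (G t) + B (F s) (G t - G s) - (integral {a..t} k - integral {a..s} k)"
      by (simp add: D_def B.diff_left B.diff_right)
    also have "integral {a..t} k - integral {a..s} k = integral {s..t} k"
      using Henstock_Kurzweil_Integration.integral_combine[of a s t k] st sub[OF kint, of a t]
      by (simp add: algebra_simps)
    also have "B (F t - F s) (G t) = integral {s..t} (\<lambda>x. B (f x) (G t))"
      using integral_linear[OF fint B.bounded_linear_left[of "G t"]] primitive_on_diff[OF F st]
      by (simp add: o_def)
    also have "B (F s) (G t - G s) = integral {s..t} (\<lambda>x. B (F s) (g x))"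
      using integral_linear[OF gint B.bounded_linear_right[of "F s"]] primitive_on_diff[OF G st]
      by (simp add: o_def)
    also have "integral {s..t} (\<lambda>x. B (f x) (G t)) + integral {s..t} (\<lambda>x. B (F s) (g x)) - integral {s..t} k
        = integral {s..t} (\<lambda>x. B (f x) (G t) + B (F s) (g x) - k x)"
    proof -
      have i1: "(\<lambda>x. B (f x) (G t)) integrable_on {s..t}" "(\<lambda>x. B (F s) (g x)) integrable_on {s..t}"
        using integrable_linear[OF fint B.bounded_linear_left[of "G t"]]
          integrable_linear[OF gint B.bounded_linear_right[of "F s"]] by (simp_all add: o_def)
      show ?thesis
        using i1 sub[OF kint] st
        by (simp add: Henstock_Kurzweil_Integration.integral_add Henstock_Kurzweil_Integration.integral_diff
            Henstock_Kurzweil_Integration.integrable_add)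
    qed
    finally have eq: "D t - D s = integral {s..t} (\<lambda>x. B (f x) (G t) + B (F s) (g x) - k x)" .
    have i2: "(\<lambda>x. B (f x) (G t) + B (F s) (g x) - k x) integrable_on {s..t}"
      using integrable_linear[OF fint B.bounded_linear_left[of "G t"]]
          integrable_linear[OF gint B.bounded_linear_right[of "F s"]] sub[OF kint] st
      by (intro Henstock_Kurzweil_Integration.integrable_add Henstock_Kurzweil_Integration.integrable_diff)
        (simp_all add: o_def)
    have "norm (D t - D s) \<le> integral {s..t} (\<lambda>x. K * e * m x)"
      unfolding eq
    proof (rule integral_norm_bound_integral[OF i2])
      show "(\<lambda>x. K * e * m x) integrable_on {s..t}"
        by (intro integrable_on_mult_right sub[OF mint] st)
      fix x assume x: "x \<in> {s..t}"
      have "B (f x) (G t) + B (F s) (g x) - k x = B (f x) (G t - G x) + B (F s - F x) (g x)"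
        by (simp add: k_def B.diff_left B.diff_right)
      also have "norm \<dots> \<le> norm (f x) * norm (G t - G x) * K + norm (F s - F x) * norm (g x) * K"
        by (rule order_trans[OF norm_triangle_ineq add_mono[OF K(2) K(2)]])
      also have "\<dots> \<le> norm (f x) * e * K + e * norm (g x) * K"
        using K(1) Fe[OF x] Ge[OF x] by (intro add_mono mult_right_mono mult_left_mono) auto
      also have "\<dots> = K * e * m x" by (simp add: m_def algebra_simps)
      finally show "norm (B (f x) (G t) + B (F s) (g x) - k x) \<le> K * e * m x" .
    qed
    then show ?thesis by simp
  qed
  have "norm (D b - D a) \<le> K * e * integral {a..b} m" if e: "e > 0" for e
  proof -
    have uc: "uniformly_continuous_on {a..b} F" "uniformly_continuous_on {a..b} G"
      using primitive_on_continuous[OF F] primitive_on_continuous[OF G]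
      by (auto intro: compact_uniformly_continuous)
    obtain d1 where d1: "d1 > 0"
      "\<And>x y. x \<in> {a..b} \<Longrightarrow> y \<in> {a..b} \<Longrightarrow> dist y x < d1 \<Longrightarrow> dist (F y) (F x) < e"
      using uc(1) e unfolding uniformly_continuous_on_def by blast
    obtain d2 where d2: "d2 > 0"
      "\<And>x y. x \<in> {a..b} \<Longrightarrow> y \<in> {a..b} \<Longrightarrow> dist y x < d2 \<Longrightarrow> dist (G y) (G x) < e"
      using uc(2) e unfolding uniformly_continuous_on_def by blast
    obtain n :: nat where n: "n > 0" "(b - a) / real n < min d1 d2"
    proof -
      have d: "min d1 d2 > 0" using d1(1) d2(1) by simp
      obtain n :: nat where "(b - a) / min d1 d2 < real n" using reals_Archimedean2 by blast
      then have "b - a < real n * min d1 d2" by (simp only: pos_divide_less_eq[OF d])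
      also have "\<dots> \<le> real (Suc n) * min d1 d2" using d by (intro mult_right_mono) auto
      finally have "(b - a) / real (Suc n) < min d1 d2"
        by (subst pos_divide_less_eq) (simp_all only: mult.commute of_nat_0_less_iff zero_less_Suc)
      then show thesis by (intro that[of "Suc n"]) auto
    qed
    \<comment> \<open>An equidistant partition that is fine enough for \<open>F\<close> and \<open>G\<close> to vary by at most \<open>e\<close> on each piece.\<close>
    define w where "w = (b - a) / real n"
    have w: "0 \<le> w" "w < d1" "w < d2" "real n * w = b - a"
      using n \<open>a \<le> b\<close> by (auto simp: w_def)
    define x where "x = (\<lambda>i::nat. a + real i * w)"
    have x0: "x 0 = a" and xn: "x n = b" by (simp_all add: x_def w(4))
    have xSuc: "x (Suc i) = x i + w" for i by (simp add: x_def distrib_right)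
    have xmono: "x i \<le> x (Suc i)" for i
      using xSuc[of i] w(1) by simp
    have xinc: "x i \<le> x j" if "i \<le> j" for i j using lift_Suc_mono_le[of x] xmono that by blast
    have xlow: "a \<le> x i" for i using xinc[of 0 i] x0 by simp
    have xup: "x i \<le> b" if "i \<le> n" for i using xinc[OF that] xn by simp
    have tel: "(\<Sum>i<n. D (x (Suc i)) - D (x i)) = D b - D a"
      using sum_lessThan_telescope[of "\<lambda>i. D (x i)" n] by (simp add: x0 xn)
    have mtel: "(\<Sum>i<n. integral {x i..x (Suc i)} m) = integral {a..b} m"
    proof -
      have "integral {x i..x (Suc i)} m = integral {a..x (Suc i)} m - integral {a..x i} m" if "i < n" for i
        using Henstock_Kurzweil_Integration.integral_combine[of a "x i" "x (Suc i)" m] xlow xmono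
          sub[OF mint, of a "x (Suc i)"] xup[of "Suc i"] that by (simp add: algebra_simps)
      then have "(\<Sum>i<n. integral {x i..x (Suc i)} m) = (\<Sum>i<n. integral {a..x (Suc i)} m - integral {a..x i} m)"
        by (intro sum.cong) auto
      also have "\<dots> = integral {a..x n} m - integral {a..x 0} m"
        using sum_lessThan_telescope[of "\<lambda>i. integral {a..x i} m" n] by simp
      finally show ?thesis by (simp add: x0 xn)
    qed
    have "norm (D b - D a) \<le> (\<Sum>i<n. norm (D (x (Suc i)) - D (x i)))"
      unfolding tel[symmetric] by (rule norm_sum)
    also have "\<dots> \<le> (\<Sum>i<n. K * e * integral {x i..x (Suc i)} m)"
    proof (intro sum_mono step)
      fix i assume "i \<in> {..<n}"
      then have i: "a \<le> x i" "x (Suc i) \<le> b" using xlow xup by auto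
      show "a \<le> x i" "x (Suc i) \<le> b" "x i \<le> x (Suc i)" using i xmono by auto
      fix y assume y: "y \<in> {x i..x (Suc i)}"
      have "dist (x i) y < d1" "dist (x (Suc i)) y < d2"
        using y xSuc[of i] w by (auto simp: dist_real_def)
      then show "norm (F (x i) - F y) \<le> e" "norm (G (x (Suc i)) - G y) \<le> e"
        using d1(2)[of y "x i"] d2(2)[of y "x (Suc i)"] y i xmono[of i]
        by (auto simp: dist_norm intro: less_imp_le)
    qed
    also have "\<dots> = K * e * integral {a..b} m"
      by (simp add: sum_distrib_left[symmetric] mtel)
    finally show ?thesis .
  qed
  then have le: "norm (D b - D a) \<le> e * (K * integral {a..b} m)" if "e > 0" for e
    unfolding mult.assoc[symmetric] mult.commute[of e K] using that .
  have "norm (D b - D a) \<le> 0"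
  proof (rule tendsto_lowerbound)
    show "((\<lambda>e. e * (K * integral {a..b} m)) \<longlongrightarrow> 0) (at_right 0)"
      by (auto intro!: tendsto_eq_intros)
    show "eventually (\<lambda>e. norm (D b - D a) \<le> e * (K * integral {a..b} m)) (at_right 0)"
      using eventually_at_right_less[of 0] by eventually_elim (rule le)
  qed simp
  then have "D b = D a" by simp
  then show ?thesis by (simp add: D_def k_def algebra_simps)
qed

section \<open>Linear systems with integrable coefficients\<close>

lemma linear_ode_integrable:
  fixes h :: "'m::euclidean_space \<Rightarrow> 'e::euclidean_space \<Rightarrow> 'e"
  assumes "bilinear h" "A absolutely_integrable_on {a..b}" "f absolutely_integrable_on {a..b}"
    and z: "continuous_on {a..b::real} z"
  shows "(\<lambda>t. h (A t) (z t) + f t) absolutely_integrable_on {a..b}"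
proof -
  have "bilinear (\<lambda>y x. h x y)"
    using assms(1) unfolding bilinear_conv_bounded_bilinear by (rule bounded_bilinear.flip)
  then have "(\<lambda>t. h (A t) (z t)) absolutely_integrable_on {a..b}"
    by (rule absolutely_integrable_bounded_measurable_product)
      (use z assms(2) in \<open>auto intro: continuous_imp_measurable_on_sets_lebesgue compact_imp_bounded compact_continuous_image\<close>)
  then show ?thesis using assms(3) by (rule set_integral_add(1))
qed

text \<open>Contraction principle for \<open>z' = h A z + f\<close>, \<open>z \<tau> = z0\<close>, on an interval on which \<open>A\<close> has small
  integral.  The initial time may be any point of the interval.\<close>
lemma linear_ode_exists:
  fixes h :: "'m::euclidean_space \<Rightarrow> 'e::euclidean_space \<Rightarrow> 'e" and z0 :: 'e
  assumes h: "bilinear h" and B: "\<And>x y. norm (h x y) \<le> B * norm x * norm y" "0 \<le> B"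
    and A: "A absolutely_integrable_on {a..b}" and f: "f absolutely_integrable_on {a..b}"
    and small: "B * integral {a..b} (\<lambda>t. norm (A t)) \<le> 1/4"
    and \<tau>: "\<tau> \<in> {a..b}"
  shows "\<exists>z. primitive_on a b (\<lambda>t. h (A t) (z t) + f t) z \<and> z \<tau> = z0"
proof -
  have ab: "a \<le> b" using \<tau> by simp
  define N where "N = (\<lambda>z t. h (A t) (z t) + f t)"
  have Nai: "N z absolutely_integrable_on {a..b}" if "continuous_on {a..b} z" for z
    unfolding N_def by (rule linear_ode_integrable[OF h A f that])
  then have Nint: "N z integrable_on {a..b}" if "continuous_on {a..b} z" for z
    using that set_lebesgue_integral_eq_integral(1) by blast
  have Aint: "(\<lambda>t. norm (A t)) integrable_on {a..b}"
    using A unfolding absolutely_integrable_on_def by blast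
  have sub: "k integrable_on {a..s}" if "k integrable_on {a..b}" "s \<in> {a..b}"
    for k :: "real \<Rightarrow> 'k::euclidean_space" and s
    using integrable_subinterval_real[OF that(1)] that(2) by auto
  \<comment> \<open>The fixed point is sought among bounded continuous functions on the whole line; the clamp \<open>c\<close>
    extends functions on \<open>[a, b]\<close> by their end values.\<close>
  define c where "c = (\<lambda>t. max a (min b t))"
  have c: "c t \<in> {a..b}" for t using ab by (auto simp: c_def)
  have c_id: "c t = t" if "t \<in> {a..b}" for t using that by (auto simp: c_def)
  define S where "S = (\<lambda>z t. z0 + integral {a..c t} (N z) - integral {a..\<tau>} (N z))"
  have Sb: "S z \<in> bcontfun" if z: "continuous_on {a..b} z" for z
  proof -
    define G where "G = (\<lambda>s. z0 + integral {a..s} (N z) - integral {a..\<tau>} (N z))"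
    have G: "continuous_on {a..b} G"
      unfolding G_def by (intro continuous_intros indefinite_integral_continuous_1 Nint z)
    have "continuous_on UNIV c" unfolding c_def by (intro continuous_intros)
    then have "continuous_on UNIV (\<lambda>t. G (c t))"
      by (rule continuous_on_compose2[OF G]) (use c in auto)
    moreover have "bounded (range (\<lambda>t. G (c t)))"
      by (rule bounded_subset[OF compact_imp_bounded[OF compact_continuous_image[OF G]]])
        (use c in auto)
    ultimately show ?thesis by (simp add: S_def G_def bcontfun_def)
  qed
  define T where "T = (\<lambda>z :: real \<Rightarrow>\<^sub>C 'e. Bcontfun (S (apply_bcontfun z)))"
  have T: "apply_bcontfun (T z) = S (apply_bcontfun z)" for z
    unfolding T_def by (rule Bcontfun_inverse[OF Sb]) simp
  \<comment> \<open>The bound \<open>1/4\<close> enters twice, at the times \<open>t\<close> and \<open>\<tau>\<close>, and gives the Lipschitz constant \<open>1/2\<close>.\<close>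
  have quarter: "norm (integral {a..s} (N z) - integral {a..s} (N w)) \<le> dist z w / 4"
    if s: "s \<in> {a..b}" for s and z w :: "real \<Rightarrow>\<^sub>C 'e"
  proof -
    have i: "N z integrable_on {a..s}" "N w integrable_on {a..s}"
      by (intro sub[OF Nint s] continuous_on_apply_bcontfun)+
    have "integral {a..s} (N z) - integral {a..s} (N w) = integral {a..s} (\<lambda>t. N z t - N w t)"
      by (rule Henstock_Kurzweil_Integration.integral_diff[OF i, symmetric])
    also have "norm \<dots> \<le> integral {a..s} (\<lambda>t. (B * dist z w) * norm (A t))"
    proof (rule integral_norm_bound_integral)
      show "(\<lambda>t. N z t - N w t) integrable_on {a..s}"
        by (rule Henstock_Kurzweil_Integration.integrable_diff[OF i])
      show "(\<lambda>t. (B * dist z w) * norm (A t)) integrable_on {a..s}"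
        by (intro integrable_on_mult_right sub[OF Aint s])
      fix t assume "t \<in> {a..s}"
      have "N z t - N w t = h (A t) (z t - w t)"
        by (simp add: N_def bilinear_rsub[OF h])
      also have "norm \<dots> \<le> B * norm (A t) * norm (z t - w t)" by (rule B)
      also have "\<dots> \<le> B * norm (A t) * dist z w"
        using dist_bounded[of z t w] B(2) by (intro mult_left_mono) (auto simp: dist_norm)
      finally show "norm (N z t - N w t) \<le> (B * dist z w) * norm (A t)" by (simp add: mult_ac)
    qed
    also have "\<dots> = (B * dist z w) * integral {a..s} (\<lambda>t. norm (A t))" by simp
    also have "\<dots> \<le> (B * dist z w) * integral {a..b} (\<lambda>t. norm (A t))"
      using B(2) s by (intro mult_left_mono integral_subset_le Aint sub[OF Aint s]) auto
    also have "\<dots> = (B * integral {a..b} (\<lambda>t. norm (A t))) * dist z w" by simp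
    also have "\<dots> \<le> (1/4) * dist z w" by (rule mult_right_mono[OF small]) simp
    finally show ?thesis by simp
  qed
  have contr: "dist (T z) (T w) \<le> (1/2) * dist z w" for z w
  proof (rule dist_bound)
    fix t
    have "dist (T z t) (T w t) = norm ((integral {a..c t} (N z) - integral {a..c t} (N w))
        - (integral {a..\<tau>} (N z) - integral {a..\<tau>} (N w)))"
      by (simp add: T S_def dist_norm algebra_simps)
    also have "\<dots> \<le> dist z w / 4 + dist z w / 4"
      by (rule order_trans[OF norm_triangle_ineq4 add_mono[OF quarter[OF c] quarter[OF \<tau>]]])
    finally show "dist (T z t) (T w t) \<le> (1/2) * dist z w" by simp
  qed
  obtain z where z: "T z = z"
    using banach_fix_type[of "1/2" T] contr by auto
  have zS: "z t = z0 + integral {a..t} (N z) - integral {a..\<tau>} (N z)" if "t \<in> {a..b}" for t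
  proof -
    have "apply_bcontfun z t = S (apply_bcontfun z) t"
      using fun_cong[OF T[of z], of t] unfolding z .
    then show ?thesis unfolding S_def c_id[OF that] .
  qed
  have "primitive_on a b (N z) z"
    unfolding primitive_on_def
  proof (intro conjI ballI)
    show "N z absolutely_integrable_on {a..b}" by (rule Nai) simp
    fix t assume "t \<in> {a..b}"
    then show "z t = z a + integral {a..t} (N z)" using zS[of t] zS[of a] ab by simp
  qed
  moreover have "z \<tau> = z0" using zS[OF \<tau>] by simp
  ultimately show ?thesis unfolding N_def by blast
qed

section \<open>Almost everywhere equality and the first quasi-derivative\<close>

lemma AE_lebesgue_on_iff_negligible:
  assumes "S \<in> sets lebesgue"
  shows "(AE x in lebesgue_on S. P x) \<longleftrightarrow> negligible {x\<in>S. \<not> P x}"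
proof -
  have "(AE x in lebesgue_on S. P x) \<longleftrightarrow> (AE x in lebesgue. x \<in> S \<longrightarrow> P x)"
    using assms by (subst AE_restrict_space_iff) auto
  also have "\<dots> \<longleftrightarrow> negligible {x\<in>S. \<not> P x}"
    unfolding completion.AE_iff_null_sets negligible_iff_null_sets
    by (rule arg_cong2[of _ _ _ _ "(\<in>)"]) auto
  finally show ?thesis .
qed

lemma continuous_AE_eq_imp_eq:
  fixes u w :: "real \<Rightarrow> 'a::real_normed_vector"
  assumes "\<alpha> < \<beta>" and u: "continuous_on {\<alpha>..\<beta>} u" and w: "continuous_on {\<alpha>..\<beta>} w"
    and ae: "AE x in lebesgue_on {\<alpha><..<\<beta>}. u x = w x" and x: "x \<in> {\<alpha>..\<beta>}"
  shows "u x = w x"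
proof -
  have d: "continuous_on {\<alpha>..\<beta>} (\<lambda>x. u x - w x)" by (intro continuous_intros u w)
  have "open ({\<alpha><..<\<beta>} \<inter> (\<lambda>x. u x - w x) -` (- {0}))"
    by (rule continuous_open_preimage[OF continuous_on_subset[OF d]]) auto
  moreover have "{\<alpha><..<\<beta>} \<inter> (\<lambda>x. u x - w x) -` (- {0}) = {x \<in> {\<alpha><..<\<beta>}. \<not> u x = w x}"
    by auto
  moreover have "negligible {x \<in> {\<alpha><..<\<beta>}. \<not> u x = w x}"
    using ae by (subst AE_lebesgue_on_iff_negligible[symmetric]) auto
  ultimately have "{x \<in> {\<alpha><..<\<beta>}. \<not> u x = w x} = {}"
    using open_not_negligible by metis
  then have eq: "u y - w y = 0" if "y \<in> {\<alpha><..<\<beta>}" for y using that by auto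
  have "u x - w x = 0"
    by (rule continuous_constant_on_closure[of "{\<alpha><..<\<beta>}" "\<lambda>x. u x - w x"])
      (use d x eq \<open>\<alpha> < \<beta>\<close> in simp_all)
  then show ?thesis by simp
qed

text \<open>The value of the first quasi-derivative at a point of \<open>[a, b]\<close>, endpoints included, depends only on
  the germ of the function there.\<close>
lemma is_D1_same_germ:
  assumes "a < b" "c \<in> {a..b}"
    and u: "is_D1 a b p Q y u" and w: "is_D1 a b p Q g w" and germ: "same_germ a b c g y"
  shows "w c = u c"
proof -
  obtain U where U: "open U" "c \<in> U" "\<And>x. x \<in> U \<Longrightarrow> x \<in> {a..b} \<Longrightarrow> g x = y x"
    using germ unfolding same_germ_def by auto
  then obtain e where e: "e > 0" "ball c e \<subseteq> U" by (meson openE)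
  define \<alpha> \<beta> where "\<alpha> = max a (c - e/2)" and "\<beta> = min b (c + e/2)"
  have ab: "\<alpha> < \<beta>" "a \<le> \<alpha>" "\<beta> \<le> b" "c \<in> {\<alpha>..\<beta>}"
    using assms(1,2) e(1) by (auto simp: \<alpha>_def \<beta>_def)
  have U': "x \<in> U" if "x \<in> {\<alpha>..\<beta>}" for x
    using that e by (auto simp: \<alpha>_def \<beta>_def dist_real_def)
  have gy: "g x = y x" if "x \<in> {\<alpha>..\<beta>}" for x
    using U(3)[OF U'[OF that]] that ab by auto
  have der: "vector_derivative g (at x) = vector_derivative y (at x)" if "x \<in> {\<alpha><..<\<beta>}" for x
  proof (rule vector_derivative_cong_eq)
    have "eventually (\<lambda>x. x \<in> {\<alpha><..<\<beta>}) (nhds x)"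
      using that by (intro eventually_nhds_in_open) auto
    then show "eventually (\<lambda>x. x \<in> UNIV \<longrightarrow> g x = y x) (nhds x)"
      by eventually_elim (use gy in auto)
  qed auto
  define Z where "Z v f = {x \<in> {a<..<b}. \<not> v x = p x *v vector_derivative f (at x) - Q x *v f x}" for v f
  have Z: "negligible (Z w g)" "negligible (Z u y)"
    using u w unfolding is_D1_def Z_def
    by (simp_all add: AE_lebesgue_on_iff_negligible)
  have "negligible {x \<in> {\<alpha><..<\<beta>}. \<not> w x = u x}"
    by (rule negligible_subset[OF negligible_Un[OF Z]]) (use der gy ab in \<open>auto simp: Z_def\<close>)
  then have ae: "AE x in lebesgue_on {\<alpha><..<\<beta>}. w x = u x"
    by (subst AE_lebesgue_on_iff_negligible) auto
  show ?thesis
  proof (rule continuous_AE_eq_imp_eq[OF ab(1) _ _ ae ab(4)])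
    show "continuous_on {\<alpha>..\<beta>} w" "continuous_on {\<alpha>..\<beta>} u"
      using u w ab unfolding is_D1_def
      by (auto intro: continuous_on_subset[OF AC_on_continuous_on])
  qed
qed

lemma is_D1_D1: "y \<in> Dom_max a b p Q \<Longrightarrow> is_D1 a b p Q y (D1 a b p Q y)"
  unfolding Dom_max_def D1_def by (auto intro: someI[of "is_D1 a b p Q y"])

lemma same_germ_refl: "same_germ a b c f f"
  unfolding same_germ_def by (rule exI[of _ UNIV]) simp

lemma is_D1_eq_D1:
  assumes "a < b" "is_D1 a b p Q y u" "c \<in> {a..b}"
  shows "D1 a b p Q y c = u c"
proof -
  have "is_D1 a b p Q y (D1 a b p Q y)"
    unfolding D1_def by (rule someI[of _ u]) fact
  then show ?thesis
    using is_D1_same_germ[OF assms(1,3,2) _ same_germ_refl] by blast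
qed

lemma is_D1_zero: "is_D1 a b p Q (\<lambda>_. 0) (\<lambda>_. 0)"
proof -
  have "AC_on a b (\<lambda>_. 0 :: complex^'s)" by (auto simp: AC_on_def intro: exI[of _ 1])
  then show ?thesis by (simp add: is_D1_def)
qed

lemma same_germ_imp_eq: "same_germ a b c f g \<Longrightarrow> c \<in> {a..b} \<Longrightarrow> f c = g c"
  unfolding same_germ_def by auto

lemma square_integrable_on_bounded:
  fixes f g :: "real \<Rightarrow> complex^'s"
  assumes f: "f \<in> borel_measurable (lebesgue_on {a<..<b})" and C: "\<And>x. x \<in> {a<..<b} \<Longrightarrow> norm (f x) \<le> C"
    and ae: "AE x in lebesgue_on {a<..<b}. g x = f x"
  shows "square_integrable_on a b g"
proof -
  let ?e = "\<lambda>h x. if x \<in> {a<..<b} then h x else (0::complex^'s)"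
  have "?e f \<in> borel_measurable lebesgue" by (rule borel_measurable_if_I[OF f]) simp
  moreover have "AE x in lebesgue. ?e f x = ?e g x"
    using ae by (subst (asm) AE_restrict_space_iff) (auto elim: eventually_mono)
  ultimately have "?e g \<in> borel_measurable lebesgue" by (rule borel_measurable_AE)
  then have g: "g \<in> borel_measurable (lebesgue_on {a<..<b})"
    by (rule borel_measurable_if_D)
  interpret finite_measure "lebesgue_on {a<..<b}"
    by (rule finite_measure_lebesgue_on) simp
  have "AE x in lebesgue_on {a<..<b}. norm ((norm (g x))\<^sup>2) \<le> C\<^sup>2"
    using ae AE_space by eventually_elim (use C in \<open>auto intro!: power_mono\<close>)
  then have "integrable (lebesgue_on {a<..<b}) (\<lambda>x. (norm (g x))\<^sup>2)"
    by (rule integrable_const_bound) (use g in measurable)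
  with g show ?thesis by (simp add: square_integrable_on_def)
qed



section \<open>The first-order system of the quasi-differential expression\<close>

text \<open>The inner product here is the real part of the Hermitian one.\<close>
lemma hermitian_inner:
  assumes "hermitian A"
  shows "(A *v x) \<bullet> y = x \<bullet> (A *v y)"
proof -
  have cnj: "A $ j $ i = cnj (A $ i $ j)" for i j
    using assms unfolding hermitian_def by (auto simp: map_matrix_def transpose_def vec_eq_iff)
  have el: "(\<alpha> * \<beta>) \<bullet> \<gamma> = \<beta> \<bullet> (cnj \<alpha> * \<gamma>)" for \<alpha> \<beta> \<gamma> :: complex
    by (simp add: inner_complex_def algebra_simps)
  have "(A *v x) \<bullet> y = (\<Sum>i\<in>UNIV. \<Sum>j\<in>UNIV. (A $ i $ j * x $ j) \<bullet> y $ i)"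
    by (simp add: inner_vec_def matrix_vector_mult_def inner_sum_left)
  also have "\<dots> = (\<Sum>i\<in>UNIV. \<Sum>j\<in>UNIV. x $ j \<bullet> (A $ j $ i * y $ i))"
    by (simp only: el cnj[symmetric])
  also have "\<dots> = (\<Sum>j\<in>UNIV. \<Sum>i\<in>UNIV. x $ j \<bullet> (A $ j $ i * y $ i))"
    by (rule sum.swap)
  also have "\<dots> = x \<bullet> (A *v y)"
    by (simp add: inner_vec_def matrix_vector_mult_def inner_sum_right)
  finally show ?thesis .
qed

lemma matrix_inv_mult_vector:
  fixes A :: "complex^'s^'s"
  assumes "invertible A"
  shows "A *v (matrix_inv A *v x) = x" "matrix_inv A *v (A *v x) = x"
proof -
  have "A ** matrix_inv A = mat 1 \<and> matrix_inv A ** A = mat 1"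
    using assms unfolding invertible_def matrix_inv_def by (rule someI_ex)
  then show "A *v (matrix_inv A *v x) = x" "matrix_inv A *v (A *v x) = x"
    by (simp_all add: matrix_vector_mul_assoc)
qed

lemma hermitian_inverse_inner:
  assumes "hermitian A" "invertible A"
  shows "(matrix_inv A *v x) \<bullet> y = x \<bullet> (matrix_inv A *v y)"
  using hermitian_inner[OF assms(1), of "matrix_inv A *v x" "matrix_inv A *v y"]
  by (simp add: matrix_inv_mult_vector[OF assms(2)])

text \<open>The coefficient functions \<open>p\<^sup>-\<^sup>1\<close>, \<open>p\<^sup>-\<^sup>1 Q\<close>, \<open>Q p\<^sup>-\<^sup>1\<close>, \<open>Q p\<^sup>-\<^sup>1 Q\<close>, collected in a tuple, and the states
  \<open>(y, D\<^sup>[\<^sup>1\<^sup>] y)\<close>.\<close>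
type_synonym 's coeffs = "(complex^'s^'s) \<times> (complex^'s^'s) \<times> (complex^'s^'s) \<times> (complex^'s^'s)"
type_synonym 's state = "(complex^'s) \<times> (complex^'s)"

text \<open>The right-hand side of the first-order system for \<open>(y, u)\<close>, as a bilinear function of the
  coefficients and the state:
  \<open>y' = p\<^sup>-\<^sup>1 Q y + p\<^sup>-\<^sup>1 u\<close> and \<open>u' = - Q p\<^sup>-\<^sup>1 Q y - Q p\<^sup>-\<^sup>1 u\<close>.\<close>
definition sys_op :: "'s::finite coeffs \<Rightarrow> 's state \<Rightarrow> 's state" where
  "sys_op = (\<lambda>(P, PQ, QP, QPQ) (y, u). (PQ *v y + P *v u, - (QPQ *v y) - QP *v u))"

lemma scaleR_matrix_mult_vector: "(r *\<^sub>R A) *v x = r *\<^sub>R (A *v x)"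
  for A :: "complex^'n^'m"
  by (simp add: vec_eq_iff matrix_vector_mult_def scaleR_sum_right)

lemma matrix_mult_scaleR_vector: "A *v (r *\<^sub>R x) = r *\<^sub>R (A *v x)"
  for A :: "complex^'n^'m"
  by (simp add: vec_eq_iff matrix_vector_mult_def scaleR_sum_right)

lemma bilinear_sys_op: "bilinear sys_op"
  unfolding bilinear_def
  by (auto intro!: linearI simp: sys_op_def algebra_simps matrix_vector_mult_add_rdistrib
      matrix_vector_right_distrib scaleR_matrix_mult_vector matrix_mult_scaleR_vector)

text \<open>The coefficients of the system at the point \<open>t\<close>.\<close>
definition coeffs :: "(real \<Rightarrow> complex^'s^'s) \<Rightarrow> (real \<Rightarrow> complex^'s^'s) \<Rightarrow> real \<Rightarrow> 's::finite coeffs" where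
  "coeffs p Q t = (matrix_inv (p t), matrix_inv (p t) ** Q t, Q t ** matrix_inv (p t),
     Q t ** matrix_inv (p t) ** Q t)"

lemma sys_op_coeffs:
  "sys_op (coeffs p Q t) z =
     (matrix_inv (p t) *v (Q t *v fst z + snd z), - (Q t *v (matrix_inv (p t) *v (Q t *v fst z + snd z))))"
  by (simp add: sys_op_def coeffs_def case_prod_unfold matrix_vector_mul_assoc[symmetric]
      matrix_vector_right_distrib)

text \<open>The (real part of the) symplectic form of the Lagrange identity.\<close>
definition skew :: "'s::finite state \<Rightarrow> 's state \<Rightarrow> real" where
  "skew v z = fst v \<bullet> snd z - snd v \<bullet> fst z"

lemma bounded_bilinear_skew: "bounded_bilinear skew"
  unfolding bilinear_conv_bounded_bilinear[symmetric] bilinear_def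
  by (auto intro!: linearI simp: skew_def inner_add_left inner_add_right algebra_simps)

text \<open>The system is Hamiltonian: the symplectic form is invariant up to the forcing term.\<close>
lemma skew_sys_op:
  assumes "hermitian (p t)" "hermitian (Q t)" "invertible (p t)"
  shows "skew v (sys_op (coeffs p Q t) z + (0, f)) + skew (sys_op (coeffs p Q t) v) z = fst v \<bullet> f"
proof -
  note sa = hermitian_inner[OF assms(2)] hermitian_inverse_inner[OF assms(1,3)]
  define v' z' where "v' = Q t *v fst v + snd v" and "z' = Q t *v fst z + snd z"
  have v: "snd v = v' - Q t *v fst v" and z: "snd z = z' - Q t *v fst z"
    by (simp_all add: v'_def z'_def)
  show ?thesis
    unfolding skew_def sys_op_coeffs v'_def[symmetric] z'_def[symmetric] v z
    by (simp add: inner_add_left inner_add_right inner_diff_left inner_diff_right sa)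
qed

text \<open>\<open>z = (y, u)\<close> is, on \<open>[\<alpha>, \<beta>]\<close>, a Caratheodory solution of the system that corresponds to
  \<open>D\<^sup>[\<^sup>2\<^sup>] y = f\<close> with \<open>u = D\<^sup>[\<^sup>1\<^sup>] y\<close>.\<close>
definition solves :: "(real \<Rightarrow> complex^'s^'s) \<Rightarrow> (real \<Rightarrow> complex^'s^'s) \<Rightarrow> real \<Rightarrow> real \<Rightarrow>
    (real \<Rightarrow> complex^'s) \<Rightarrow> (real \<Rightarrow> 's::finite state) \<Rightarrow> bool" where
  "solves p Q \<alpha> \<beta> f z \<longleftrightarrow> primitive_on \<alpha> \<beta> (\<lambda>t. sys_op (coeffs p Q t) (z t) + (0, f t)) z"

lemma solves_add:
  assumes "solves p Q \<alpha> \<beta> f z" "solves p Q \<alpha> \<beta> g w"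
  shows "solves p Q \<alpha> \<beta> (\<lambda>t. f t + g t) (\<lambda>t. z t + w t)"
  unfolding solves_def
  by (rule primitive_on_spike[OF primitive_on_add[OF assms[unfolded solves_def]], of "{}"])
    (auto simp: bilinear_radd[OF bilinear_sys_op])

lemma solves_scaleR:
  assumes "solves p Q \<alpha> \<beta> f z"
  shows "solves p Q \<alpha> \<beta> (\<lambda>t. r *\<^sub>R f t) (\<lambda>t. r *\<^sub>R z t)"
  unfolding solves_def
  by (rule primitive_on_spike[OF primitive_on_linear[OF assms[unfolded solves_def] bounded_linear_scaleR_right[of r]], of "{}"])
    (auto simp: bilinear_rmul[OF bilinear_sys_op] scaleR_add_right)

lemma solves_zero: "solves p Q \<alpha> \<beta> (\<lambda>_. 0) (\<lambda>_. 0)"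
  unfolding solves_def
  by (rule primitive_on_spike[OF primitive_on_zero, of "{}"])
    (auto simp: sys_op_coeffs zero_prod_def)

text \<open>A quasi-differential expression on \<open>(a, b)\<close>: Hermitian coefficients, \<open>p\<close> invertible almost
  everywhere, and the four coefficient functions of the system integrable.\<close>
locale quasi_expression =
  fixes a b :: real and p Q :: "real \<Rightarrow> complex^'s::finite^'s"
  assumes ab: "a < b"
    and hermitian_p: "\<And>x. x \<in> {a<..<b} \<Longrightarrow> hermitian (p x)"
    and hermitian_Q: "\<And>x. x \<in> {a<..<b} \<Longrightarrow> hermitian (Q x)"
    and invertible_p: "AE x in lebesgue_on {a<..<b}. invertible (p x)"
    and coeffs_integrable: "coeffs p Q absolutely_integrable_on {a..b}"
begin

lemma Lagrange_identity:
  assumes "a \<le> \<alpha>" "\<alpha> \<le> \<beta>" "\<beta> \<le> b"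
    and v: "solves p Q \<alpha> \<beta> (\<lambda>_. 0) v" and z: "solves p Q \<alpha> \<beta> f z"
  shows "skew (v \<beta>) (z \<beta>) - skew (v \<alpha>) (z \<alpha>) = integral {\<alpha>..\<beta>} (\<lambda>t. fst (v t) \<bullet> f t)"
proof -
  have "skew (v \<beta>) (z \<beta>) - skew (v \<alpha>) (z \<alpha>) = integral {\<alpha>..\<beta>} (\<lambda>t.
      skew (v t) (sys_op (coeffs p Q t) (z t) + (0, f t)) + skew (sys_op (coeffs p Q t) (v t) + (0, 0)) (z t))"
    by (rule primitive_on_product_rule[OF bounded_bilinear_skew v[unfolded solves_def] z[unfolded solves_def] assms(2)])
  also have "\<dots> = integral {\<alpha>..\<beta>} (\<lambda>t. fst (v t) \<bullet> f t)"
  proof (rule integral_spike)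
    show "negligible ({x\<in>{a<..<b}. \<not> invertible (p x)} \<union> {\<alpha>, \<beta>})"
      using invertible_p by (intro negligible_Un) (auto simp: AE_lebesgue_on_iff_negligible)
    fix t assume "t \<in> {\<alpha>..\<beta>} - ({x\<in>{a<..<b}. \<not> invertible (p x)} \<union> {\<alpha>, \<beta>})"
    then have "t \<in> {a<..<b}" "invertible (p t)" using assms(1,3) by auto
    then show "fst (v t) \<bullet> f t = skew (v t) (sys_op (coeffs p Q t) (z t) + (0, f t))
        + skew (sys_op (coeffs p Q t) (v t) + (0, 0)) (z t)"
      using skew_sys_op[OF hermitian_p hermitian_Q, where v = "v t" and z = "z t" and f = "f t"]
      unfolding zero_prod_def[symmetric] add_0_right by simp
  qed
  finally show ?thesis .
qed

text \<open>If \<open>y\<close> vanishes then so does \<open>p\<^sup>-\<^sup>1 u = y' - p\<^sup>-\<^sup>1 Q y\<close>, and hence \<open>u\<close>.\<close>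
lemma solves_fst_zero:
  assumes "a \<le> \<alpha>" "\<alpha> < \<beta>" "\<beta> \<le> b" and v: "solves p Q \<alpha> \<beta> f v"
    and v0: "\<And>t. t \<in> {\<alpha>..\<beta>} \<Longrightarrow> fst (v t) = 0" and t: "t \<in> {\<alpha>..\<beta>}"
  shows "v t = 0"
proof -
  have fst_v: "primitive_on \<alpha> \<beta> (\<lambda>t. fst (sys_op (coeffs p Q t) (v t) + (0, f t))) (\<lambda>t. fst (v t))"
    by (rule primitive_on_linear[OF v[unfolded solves_def] bounded_linear_fst])
  have "negligible {x\<in>{a<..<b}. \<not> invertible (p x)}"
    using invertible_p by (simp add: AE_lebesgue_on_iff_negligible)
  then have "negligible {x\<in>{\<alpha><..<\<beta>}. \<not> invertible (p x)}"
    by (rule negligible_subset) (use assms(1,3) in auto)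
  then have inv: "AE x in lebesgue_on {\<alpha><..<\<beta>}. invertible (p x)"
    by (simp add: AE_lebesgue_on_iff_negligible)
  have "AE x in lebesgue_on {\<alpha><..<\<beta>}. snd (v x) = 0"
    using inv primitive_on_AE_has_vector_derivative[OF fst_v] AE_space
  proof eventually_elim
    case (elim x)
    then have x: "x \<in> {\<alpha><..<\<beta>}" by simp
    have "((\<lambda>_. 0) has_vector_derivative fst (sys_op (coeffs p Q x) (v x) + (0, f x))) (at x)"
      by (rule has_vector_derivative_transform_within_open[OF elim(2), of "{\<alpha><..<\<beta>}"])
        (use x v0 in auto)
    then have "fst (sys_op (coeffs p Q x) (v x) + (0, f x)) = 0"
      using vector_derivative_unique_at[OF _ has_vector_derivative_const] by blast
    then have "matrix_inv (p x) *v snd (v x) = 0"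
      using v0[of x] x by (simp add: sys_op_coeffs)
    then have "p x *v (matrix_inv (p x) *v snd (v x)) = 0" by simp
    then show ?case by (simp only: matrix_inv_mult_vector[OF elim(1)])
  qed
  then have "snd (v t) = 0"
    by (rule continuous_AE_eq_imp_eq[OF \<open>\<alpha> < \<beta>\<close> _ _ _ t, rotated 2])
      (use primitive_on_continuous[OF v[unfolded solves_def]] in \<open>auto intro: continuous_on_snd\<close>)
  then show ?thesis using v0[OF t] by (simp add: prod_eq_iff)
qed

end

section \<open>Controllability and elements of the maximal domain\<close>

context quasi_expression
begin

text \<open>Every initial value problem on \<open>[\<alpha>, \<beta>]\<close> with continuous forcing and initial time anywhere in the
  interval has a solution.\<close>
definition solvable :: "real \<Rightarrow> real \<Rightarrow> bool" where
  "solvable \<alpha> \<beta> \<longleftrightarrow> (\<forall>f \<tau> z0. continuous_on {\<alpha>..\<beta>} f \<longrightarrow> \<tau> \<in> {\<alpha>..\<beta>} \<longrightarrow>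
     (\<exists>z. solves p Q \<alpha> \<beta> f z \<and> z \<tau> = z0))"

lemma solvableI:
  assumes B: "0 < B" "\<And>x y. norm (sys_op x y :: 's state) \<le> B * norm x * norm y"
    and "a \<le> \<alpha>" "\<beta> \<le> b" and small: "integral {\<alpha>..\<beta>} (\<lambda>t. norm (coeffs p Q t)) \<le> 1 / (4 * B)"
  shows "solvable \<alpha> \<beta>"
  unfolding solvable_def
proof (intro allI impI)
  fix f :: "real \<Rightarrow> complex^'s" and \<tau> and z0 :: "'s state"
  assume f: "continuous_on {\<alpha>..\<beta>} f" and \<tau>: "\<tau> \<in> {\<alpha>..\<beta>}"
  show "\<exists>z. solves p Q \<alpha> \<beta> f z \<and> z \<tau> = z0"
    unfolding solves_def
  proof (rule linear_ode_exists[OF bilinear_sys_op B(2) less_imp_le[OF B(1)] _ _ _ \<tau>])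
    show "coeffs p Q absolutely_integrable_on {\<alpha>..\<beta>}"
      by (rule absolutely_integrable_on_subinterval[OF coeffs_integrable]) (use assms in auto)
    show "(\<lambda>t. (0 :: complex^'s, f t)) absolutely_integrable_on {\<alpha>..\<beta>}"
      by (rule absolutely_integrable_continuous_real) (intro continuous_on_Pair continuous_on_const f)
    show "B * integral {\<alpha>..\<beta>} (\<lambda>t. norm (coeffs p Q t)) \<le> 1 / 4"
      using small B(1) by (simp add: field_simps)
  qed
qed

lemma solvable_near_endpoints:
  obtains c d where "a < c" "c < b" "a < d" "d < b" "solvable a c" "solvable d b"
proof -
  obtain B where B: "0 < B" "\<And>x y. norm (sys_op x y :: 's state) \<le> B * norm x * norm y"
    using bilinear_bounded_pos[OF bilinear_sys_op] by blast
  define m where "m = (\<lambda>t. norm (coeffs p Q t))"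
  have m: "m integrable_on {a..b}"
    using coeffs_integrable unfolding m_def absolutely_integrable_on_def by blast
  have e: "1 / (4 * B) > 0" using B by simp
  obtain \<delta> where \<delta>: "\<delta> > 0" "\<And>x. x \<in> {a..b} \<Longrightarrow> dist x a < \<delta> \<Longrightarrow>
      dist (integral {a..x} m) (integral {a..a} m) < 1 / (4 * B)"
    using indefinite_integral_continuous_1[OF m] e ab unfolding continuous_on_iff
    by (meson atLeastAtMost_iff less_imp_le order_refl)
  obtain \<eta> where \<eta>: "\<eta> > 0" "\<And>x. x \<in> {a..b} \<Longrightarrow> dist x b < \<eta> \<Longrightarrow>
      dist (integral {x..b} m) (integral {b..b} m) < 1 / (4 * B)"
    using indefinite_integral_continuous_1'[OF m] e ab unfolding continuous_on_iff
    by (meson atLeastAtMost_iff less_imp_le order_refl)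
  define c where "c = a + min \<delta> (b - a) / 2"
  define d where "d = b - min \<eta> (b - a) / 2"
  have c: "a < c" "c < b" "dist c a < \<delta>" using ab \<delta>(1) by (auto simp: c_def dist_real_def min_def field_simps)
  have d: "a < d" "d < b" "dist d b < \<eta>" using ab \<eta>(1) by (auto simp: d_def dist_real_def min_def field_simps)
  have "integral {a..c} m \<le> 1 / (4 * B)"
    using \<delta>(2)[of c] c by (simp add: dist_real_def)
  moreover have "integral {d..b} m \<le> 1 / (4 * B)"
    using \<eta>(2)[of d] d by (simp add: dist_real_def)
  ultimately show thesis
    using c d by (intro that[of c d] solvableI[OF B]) (auto simp: m_def)
qed

text \<open>The set \<open>R\<close> of states reachable from \<open>0\<close> is a subspace; a vector orthogonal to it is shown to be
  zero by means of the Lagrange identity.\<close>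
lemma controllable_from_zero:
  assumes \<alpha>\<beta>: "a \<le> \<alpha>" "\<alpha> < \<beta>" "\<beta> \<le> b" and solv: "solvable \<alpha> \<beta>"
  shows "\<exists>f z. continuous_on {\<alpha>..\<beta>} f \<and> solves p Q \<alpha> \<beta> f z \<and> z \<alpha> = 0 \<and> z \<beta> = z1"
proof -
  define R where "R = {z1. \<exists>f z. continuous_on {\<alpha>..\<beta>} f \<and> solves p Q \<alpha> \<beta> f z \<and> z \<alpha> = 0 \<and> z \<beta> = z1}"
  have R: "subspace R"
    unfolding subspace_def
  proof (intro conjI ballI allI)
    show "0 \<in> R"
      unfolding R_def using solves_zero continuous_on_const by blast
    fix x assume "x \<in> R"
    then obtain f z where f: "continuous_on {\<alpha>..\<beta>} f" "solves p Q \<alpha> \<beta> f z" "z \<alpha> = 0" "z \<beta> = x"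
      unfolding R_def by blast
    show "r *\<^sub>R x \<in> R" for r
      unfolding R_def
      using solves_scaleR[OF f(2), of r] f continuous_on_scaleR[OF continuous_on_const f(1), of r]
      by (intro CollectI exI[of _ "\<lambda>t. r *\<^sub>R f t"] exI[of _ "\<lambda>t. r *\<^sub>R z t"]) auto
    fix y assume "y \<in> R"
    then obtain g w where g: "continuous_on {\<alpha>..\<beta>} g" "solves p Q \<alpha> \<beta> g w" "w \<alpha> = 0" "w \<beta> = y"
      unfolding R_def by blast
    show "x + y \<in> R"
      unfolding R_def
      using solves_add[OF f(2) g(2)] f g continuous_on_add[OF f(1) g(1)]
      by (intro CollectI exI[of _ "\<lambda>t. f t + g t"] exI[of _ "\<lambda>t. z t + w t"]) auto
  qed
  obtain r w where r: "r \<in> span R" and w: "\<And>x. x \<in> span R \<Longrightarrow> orthogonal w x" and z1: "z1 = r + w"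
    using orthogonal_subspace_decomp_exists[of R z1] by blast
  \<comment> \<open>The end value is chosen so that \<open>skew (v \<beta>) x\<close> is the inner product of \<open>w\<close> and \<open>x\<close>.\<close>
  obtain v where v: "solves p Q \<alpha> \<beta> (\<lambda>_. 0) v" "v \<beta> = (snd w, - fst w)"
    using solv \<alpha>\<beta> continuous_on_const unfolding solvable_def by (metis atLeastAtMost_iff less_imp_le order_refl)
  have fst_v: "continuous_on {\<alpha>..\<beta>} (\<lambda>t. fst (v t))"
    using primitive_on_continuous[OF v(1)[unfolded solves_def]] by (rule continuous_on_fst)
  obtain z where z: "solves p Q \<alpha> \<beta> (\<lambda>t. fst (v t)) z" "z \<alpha> = 0"
    using solv \<alpha>\<beta> fst_v unfolding solvable_def by (metis atLeastAtMost_iff less_imp_le order_refl)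
  have "z \<beta> \<in> R" unfolding R_def using z fst_v by blast
  then have "w \<bullet> z \<beta> = 0" using w span_superset unfolding orthogonal_def by blast
  then have "skew (v \<beta>) (z \<beta>) = 0" by (simp add: v(2) skew_def inner_prod_def)
  then have "integral {\<alpha>..\<beta>} (\<lambda>t. fst (v t) \<bullet> fst (v t)) = 0"
    using Lagrange_identity[OF \<alpha>\<beta>(1) less_imp_le[OF \<alpha>\<beta>(2)] \<alpha>\<beta>(3) v(1) z(1)] z(2)
    by (simp add: skew_def)
  then have "\<forall>t\<in>{\<alpha>..\<beta>}. fst (v t) \<bullet> fst (v t) = 0"
    by (subst (asm) integral_eq_0_iff) (use \<alpha>\<beta>(2) fst_v in \<open>auto intro!: continuous_on_inner\<close>)
  then have "v \<beta> = 0"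
    using solves_fst_zero[OF \<alpha>\<beta> v(1), of \<beta>] \<alpha>\<beta> by simp
  then have "w = 0" using v(2) by (simp add: prod_eq_iff)
  then have "z1 \<in> R" using r z1 R by (simp add: span_eq_iff[THEN iffD2])
  then show ?thesis unfolding R_def by blast
qed

lemma controllable:
  assumes \<alpha>\<beta>: "a \<le> \<alpha>" "\<alpha> < \<beta>" "\<beta> \<le> b" and solv: "solvable \<alpha> \<beta>"
  obtains f z where "continuous_on {\<alpha>..\<beta>} f" "solves p Q \<alpha> \<beta> f z" "z \<alpha> = z0" "z \<beta> = z1"
proof -
  obtain w where w: "solves p Q \<alpha> \<beta> (\<lambda>_. 0) w" "w \<alpha> = z0"
    using solv \<alpha>\<beta> continuous_on_const unfolding solvable_def by (metis atLeastAtMost_iff less_imp_le order_refl)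
  obtain f z where f: "continuous_on {\<alpha>..\<beta>} f" "solves p Q \<alpha> \<beta> f z" "z \<alpha> = 0" "z \<beta> = z1 - w \<beta>"
    using controllable_from_zero[OF assms] by blast
  show thesis
    by (rule that[of "\<lambda>t. 0 + f t" "\<lambda>t. w t + z t"])
      (use f w solves_add[OF w(1) f(2)] in auto)
qed

text \<open>Solutions with bounded measurable forcing give elements of the maximal domain, and the second
  component is the first quasi-derivative.\<close>
lemma solves_Dom_max:
  assumes z: "solves p Q a b f z" and f: "f \<in> borel_measurable (lebesgue_on {a<..<b})"
    and C: "\<And>t. t \<in> {a<..<b} \<Longrightarrow> norm (f t) \<le> C"
  shows "(\<lambda>t. fst (z t)) \<in> Dom_max a b p Q" "is_D1 a b p Q (\<lambda>t. fst (z t)) (\<lambda>t. snd (z t))"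
proof -
  let ?y = "\<lambda>t. fst (z t)" and ?u = "\<lambda>t. snd (z t)"
  have y: "primitive_on a b (\<lambda>t. fst (sys_op (coeffs p Q t) (z t) + (0, f t))) ?y"
    and u: "primitive_on a b (\<lambda>t. snd (sys_op (coeffs p Q t) (z t) + (0, f t))) ?u"
    by (rule primitive_on_linear[OF z[unfolded solves_def]], intro bounded_linear_fst bounded_linear_snd)+
  show D1: "is_D1 a b p Q ?y ?u"
    unfolding is_D1_def
  proof (intro conjI)
    show "AC_on a b ?u" by (rule primitive_on_AC_on[OF u])
    show "AE x in lebesgue_on {a<..<b}. ?u x = p x *v vector_derivative ?y (at x) - Q x *v ?y x"
      using invertible_p primitive_on_AE_has_vector_derivative[OF y]
    proof eventually_elim
      case (elim x)
      from vector_derivative_at[OF elim(2)] elim(1) show ?case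
        by (simp add: sys_op_coeffs matrix_inv_mult_vector)
    qed
  qed
  have D1u: "D1 a b p Q ?y x = ?u x" if "x \<in> {a..b}" for x
    by (rule is_D1_eq_D1[OF ab D1 that])
  have "AE x in lebesgue_on {a<..<b}. D2 a b p Q ?y x = f x"
    using primitive_on_AE_has_vector_derivative[OF u] AE_space
  proof eventually_elim
    case (elim x)
    then have x: "x \<in> {a<..<b}" by simp
    have "(D1 a b p Q ?y has_vector_derivative snd (sys_op (coeffs p Q x) (z x) + (0, f x))) (at x)"
      by (rule has_vector_derivative_transform_within_open[OF elim(1), of "{a<..<b}"])
        (use x D1u in auto)
    then have "vector_derivative (D1 a b p Q ?y) (at x) = snd (sys_op (coeffs p Q x) (z x) + (0, f x))"
      by (rule vector_derivative_at)
    then show ?case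
      using D1u[of x] x unfolding D2_def
      by (simp add: sys_op_coeffs matrix_vector_mul_assoc[symmetric] matrix_vector_right_distrib)
  qed
  with f C have D2: "square_integrable_on a b (D2 a b p Q ?y)"
    by (rule square_integrable_on_bounded)
  have cont: "continuous_on {a..b} ?y" by (rule primitive_on_continuous[OF y])
  have "bounded (?y ` {a..b})"
    by (rule compact_imp_bounded[OF compact_continuous_image[OF cont compact_Icc]])
  then obtain M where M: "\<And>x. x \<in> {a..b} \<Longrightarrow> norm (?y x) \<le> M"
    unfolding bounded_iff by blast
  have "square_integrable_on a b ?y"
  proof (rule square_integrable_on_bounded)
    show "?y \<in> borel_measurable (lebesgue_on {a<..<b})"
      by (rule continuous_imp_measurable_on_sets_lebesgue[OF continuous_on_subset[OF cont]]) auto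
    show "norm (?y x) \<le> M" if "x \<in> {a<..<b}" for x using M that by auto
  qed simp
  then show "?y \<in> Dom_max a b p Q"
    unfolding Dom_max_def mem_Collect_eq
    by (intro conjI exI primitive_on_AC_on[OF y]) (rule D1 D2 | assumption)+
qed

end

section \<open>Realisation of boundary data\<close>

context quasi_expression
begin

lemma solves_extend_by_zero:
  assumes \<alpha>\<beta>: "a \<le> \<alpha>" "\<alpha> < \<beta>" "\<beta> \<le> b" and z: "solves p Q \<alpha> \<beta> f z"
    and left: "\<alpha> = a \<or> z \<alpha> = 0" and right: "\<beta> = b \<or> z \<beta> = 0"
  shows "solves p Q a b (\<lambda>t. if t \<in> {\<alpha>..\<beta>} then f t else 0) (\<lambda>t. if t \<in> {\<alpha>..\<beta>} then z t else 0)"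
    (is "solves p Q a b ?f ?z")
proof -
  have mid: "solves p Q \<alpha> \<beta> ?f ?z"
    unfolding solves_def
    by (rule primitive_on_spike[OF z[unfolded solves_def], of "{}"]) auto
  \<comment> \<open>At \<open>\<alpha>\<close> and at \<open>\<beta>\<close> the extended forcing is given by \<open>f\<close> and need not vanish; a single point does not
    matter for the integral.\<close>
  have "solves p Q a \<alpha> ?f ?z"
  proof (cases "\<alpha> = a")
    case True
    then show ?thesis
      using primitive_on_subinterval[OF mid[unfolded solves_def], of a \<alpha>] \<alpha>\<beta> by (simp add: solves_def)
  next
    case False
    then show ?thesis
      unfolding solves_def
      using left \<alpha>\<beta>
      by (intro primitive_on_spike[OF primitive_on_zero, of "{\<alpha>}"])
        (auto simp: sys_op_coeffs zero_prod_def)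
  qed
  moreover have "solves p Q \<beta> b ?f ?z"
  proof (cases "\<beta> = b")
    case True
    then show ?thesis
      using primitive_on_subinterval[OF mid[unfolded solves_def], of \<beta> b] \<alpha>\<beta> by (simp add: solves_def)
  next
    case False
    then show ?thesis
      unfolding solves_def
      using right \<alpha>\<beta>
      by (intro primitive_on_spike[OF primitive_on_zero, of "{\<beta>}"])
        (auto simp: sys_op_coeffs zero_prod_def)
  qed
  ultimately show ?thesis
    using mid \<alpha>\<beta> unfolding solves_def
    by (blast intro: primitive_on_combine[OF primitive_on_combine] less_imp_le order_trans)
qed

text \<open>Bounded measurable forcing terms on \<open>(a, b)\<close>.\<close>
definition admissible :: "(real \<Rightarrow> complex^'s) \<Rightarrow> bool" where
  "admissible f \<longleftrightarrow> f \<in> borel_measurable (lebesgue_on {a<..<b}) \<and> (\<exists>C. \<forall>t\<in>{a<..<b}. norm (f t) \<le> C)"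

lemma admissible_add: "admissible f \<Longrightarrow> admissible g \<Longrightarrow> admissible (\<lambda>t. f t + g t)"
  unfolding admissible_def
  by (auto intro!: borel_measurable_add) (meson add_mono greaterThanLessThan_iff norm_triangle_le)

lemma admissible_extend_by_zero:
  assumes f: "continuous_on {\<alpha>..\<beta>} f"
  shows "admissible (\<lambda>t. if t \<in> {\<alpha>..\<beta>} then f t else 0)"
  unfolding admissible_def
proof
  have "f \<in> borel_measurable (lebesgue_on {\<alpha>..\<beta>})"
    by (rule continuous_imp_measurable_on_sets_lebesgue[OF f]) simp
  then have "(\<lambda>t. if t \<in> {\<alpha>..\<beta>} then f t else 0) \<in> borel_measurable lebesgue"
    by (rule borel_measurable_if_I) simp
  then show "(\<lambda>t. if t \<in> {\<alpha>..\<beta>} then f t else 0) \<in> borel_measurable (lebesgue_on {a<..<b})"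
    by (rule measurable_restrict_space1)
  have "bounded (f ` {\<alpha>..\<beta>})"
    by (rule compact_imp_bounded[OF compact_continuous_image[OF f compact_Icc]])
  then obtain M where "M > 0" "\<And>x. x \<in> {\<alpha>..\<beta>} \<Longrightarrow> norm (f x) \<le> M"
    unfolding bounded_pos by blast
  then show "\<exists>C. \<forall>t\<in>{a<..<b}. norm (if t \<in> {\<alpha>..\<beta>} then f t else 0) \<le> C"
    by (intro exI[of _ M]) auto
qed

lemma solves_in_Dom_max:
  assumes "solves p Q a b f z" "admissible f"
  shows "(\<lambda>t. fst (z t)) \<in> Dom_max a b p Q"
    and "t \<in> {a..b} \<Longrightarrow> D1 a b p Q (\<lambda>t. fst (z t)) t = snd (z t)"
proof -
  obtain C where "\<And>t. t \<in> {a<..<b} \<Longrightarrow> norm (f t) \<le> C" "f \<in> borel_measurable (lebesgue_on {a<..<b})"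
    using assms(2) unfolding admissible_def by blast
  note D = solves_Dom_max[OF assms(1) this(2,1)]
  show "(\<lambda>t. fst (z t)) \<in> Dom_max a b p Q" by (rule D(1))
  show "t \<in> {a..b} \<Longrightarrow> D1 a b p Q (\<lambda>t. fst (z t)) t = snd (z t)"
    by (rule is_D1_eq_D1[OF ab D(2)])
qed

text \<open>The functions \<open>g\<close> and \<open>h\<close> vanish away from the endpoint whose data they carry, and \<open>y = g + h\<close>.\<close>
lemma boundary_data_realized:
  obtains y g h where "y \<in> Dom_max a b p Q" "g \<in> Dom_max a b p Q" "h \<in> Dom_max a b p Q"
    "same_germ a b a g y" "same_germ a b b g (\<lambda>_. 0)" "same_germ a b a h (\<lambda>_. 0)" "same_germ a b b h y"
    "y a = y1" "D1 a b p Q y a = u1" "y b = y2" "D1 a b p Q y b = u2"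
proof -
  obtain c d where cd: "a < c" "c < b" "a < d" "d < b" "solvable a c" "solvable d b"
    by (rule solvable_near_endpoints)
  obtain f1 z1 where 1: "continuous_on {a..c} f1" "solves p Q a c f1 z1" "z1 a = (y1, u1)" "z1 c = 0"
    using controllable[OF order_refl cd(1) less_imp_le[OF cd(2)] cd(5)] by blast
  obtain f2 z2 where 2: "continuous_on {d..b} f2" "solves p Q d b f2 z2" "z2 d = 0" "z2 b = (y2, u2)"
    using controllable[OF less_imp_le[OF cd(3)] cd(4) order_refl cd(6)] by blast
  define F1 w1 where "F1 t = (if t \<in> {a..c} then f1 t else 0)" and "w1 t = (if t \<in> {a..c} then z1 t else 0)" for t
  define F2 w2 where "F2 t = (if t \<in> {d..b} then f2 t else 0)" and "w2 t = (if t \<in> {d..b} then z2 t else 0)" for t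
  have s1: "solves p Q a b F1 w1"
    unfolding F1_def w1_def
    by (rule solves_extend_by_zero[OF order_refl cd(1) less_imp_le[OF cd(2)] 1(2)]) (use 1(4) in auto)
  have s2: "solves p Q a b F2 w2"
    unfolding F2_def w2_def
    by (rule solves_extend_by_zero[OF less_imp_le[OF cd(3)] cd(4) order_refl 2(2)]) (use 2(3) in auto)
  have a1: "admissible F1" and a2: "admissible F2"
    unfolding F1_def F2_def by (intro admissible_extend_by_zero 1(1) 2(1))+
  have w1a: "w1 a = (y1, u1)" and w1b: "w1 b = 0" and w2a: "w2 a = 0" and w2b: "w2 b = (y2, u2)"
    using 1 2 cd by (simp_all add: w1_def w2_def)
  note D1' = solves_in_Dom_max[OF s1 a1] and D2' = solves_in_Dom_max[OF s2 a2]
    and D = solves_in_Dom_max[OF solves_add[OF s1 s2] admissible_add[OF a1 a2]]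
  have near_a: "w2 t = 0" if "t < d" for t using that by (simp add: w2_def)
  have near_b: "w1 t = 0" if "c < t" for t using that by (simp add: w1_def)
  show thesis
  proof (rule that[OF D(1) D1'(1) D2'(1)])
    show "same_germ a b a (\<lambda>t. fst (w1 t)) (\<lambda>t. fst (w1 t + w2 t))"
      "same_germ a b a (\<lambda>t. fst (w2 t)) (\<lambda>_. 0)"
      unfolding same_germ_def using cd near_a by (auto intro!: exI[of _ "{..<d}"])
    show "same_germ a b b (\<lambda>t. fst (w1 t)) (\<lambda>_. 0)"
      "same_germ a b b (\<lambda>t. fst (w2 t)) (\<lambda>t. fst (w1 t + w2 t))"
      unfolding same_germ_def using cd near_b by (auto intro!: exI[of _ "{c<..}"])
  qed (use ab D(2) w1a w1b w2a w2b in auto)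
qed

lemma same_germ_boundary_values:
  assumes "y \<in> Dom_max a b p Q" "g \<in> Dom_max a b p Q" "c \<in> {a..b}"
  shows "same_germ a b c g y \<Longrightarrow> g c = y c \<and> D1 a b p Q g c = D1 a b p Q y c"
    and "same_germ a b c g (\<lambda>_. 0) \<Longrightarrow> g c = 0 \<and> D1 a b p Q g c = 0"
  using is_D1_same_germ[OF ab assms(3) is_D1_D1[OF assms(1)] is_D1_D1[OF assms(2)]]
    is_D1_same_germ[OF ab assms(3) is_D1_zero is_D1_D1[OF assms(2)]]
    same_germ_imp_eq[OF _ assms(3), of g] by auto

end

section \<open>Linear algebra of the boundary form\<close>

lemma vec_pair_nth [simp]: "vec_pair u v $ Inl j = u $ j" "vec_pair u v $ Inr j = v $ j"
  by (simp_all add: vec_pair_def)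

lemma vec_pair_eq_iff: "x = y \<longleftrightarrow> (\<forall>j. x $ Inl j = y $ Inl j) \<and> (\<forall>j. x $ Inr j = y $ Inr j)"
  for x y :: "'a^('s::finite + 't::finite)"
  by (auto simp: vec_eq_iff) (metis sum.exhaust)

lemma sum_UNIV_sum_type: "(\<Sum>j\<in>UNIV. f j) = (\<Sum>j\<in>UNIV. f (Inl j)) + (\<Sum>j\<in>UNIV. f (Inr j))"
  for f :: "'s::finite + 't::finite \<Rightarrow> 'a::comm_monoid_add"
proof -
  have "(\<Sum>j\<in>UNIV <+> UNIV. f j) = (\<Sum>j\<in>UNIV. f (Inl j)) + (\<Sum>j\<in>UNIV. f (Inr j))"
    by (subst sum.Plus) (simp_all add: o_def)
  then show ?thesis by simp
qed

lemma vec_pair_components: "\<exists>u v. x = vec_pair u v"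
proof (intro exI)
  show "x = vec_pair (\<chi> j. x $ Inl j) (\<chi> j. x $ Inr j)" by (simp add: vec_pair_eq_iff)
qed

lemma block_diag_mult_vec_pair: "block_diag A B *v vec_pair u v = vec_pair (A *v u) (B *v v)"
  by (simp add: vec_pair_eq_iff matrix_vector_mult_def sum_UNIV_sum_type block_diag_def)

lemma vec_pair_add: "vec_pair u v + vec_pair u' v' = vec_pair (u + u') (v + v')"
  and vec_pair_diff: "vec_pair u v - vec_pair u' v' = vec_pair (u - u') (v - v')"
  and vec_pair_scale: "c *s vec_pair u v = vec_pair (c *s u) (c *s v)"
  and vec_pair_zero: "vec_pair 0 0 = 0"
  and vec_pair_inject: "vec_pair u v = vec_pair u' v' \<longleftrightarrow> u = u' \<and> v = v'"
  by (simp_all add: vec_pair_eq_iff vec_eq_iff)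

text \<open>The left-hand side of the boundary condition, for boundary data \<open>x\<close> and \<open>y\<close>: \<open>\<sigma> = \<i>\<close> gives
  \<open>L_sub\<close> and \<open>\<sigma> = -\<i>\<close> gives \<open>L_sup\<close>.\<close>
definition boundary_form :: "complex \<Rightarrow> complex^('s + 's)^('s + 's) \<Rightarrow> complex^('s::finite + 's) \<Rightarrow> complex^('s + 's) \<Rightarrow> complex^('s + 's)" where
  "boundary_form \<sigma> K x y = (K - mat 1) *v x + \<sigma> *s ((K + mat 1) *v y)"

lemma boundary_form_block_diag:
  "boundary_form \<sigma> (block_diag A B) (vec_pair x1 x2) (vec_pair y1 y2) =
   vec_pair ((A - mat 1) *v x1 + \<sigma> *s ((A + mat 1) *v y1)) ((B - mat 1) *v x2 + \<sigma> *s ((B + mat 1) *v y2))"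
  by (simp add: boundary_form_def matrix_vector_mult_diff_rdistrib matrix_vector_mult_add_rdistrib
      block_diag_mult_vec_pair vec_pair_add vec_pair_diff vec_pair_scale)

lemma matrix_vector_mult_minus_right: "A *v (- x) = - (A *v x)"
  for A :: "complex^'n^'m"
  by (simp add: vec_eq_iff matrix_vector_mult_def sum_negf)

text \<open>Elements of the kernel of the boundary form, obtained from \<open>(K - I) (K + I) = (K + I) (K - I)\<close>.\<close>
lemma boundary_form_kernel:
  "boundary_form \<sigma> K (- \<sigma> *s ((K + mat 1) *v w)) ((K - mat 1) *v w) = 0"
  by (simp add: boundary_form_def vector_scalar_commute matrix_vector_mult_minus_right matrix_vector_mult_diff_rdistrib
      matrix_vector_mult_add_rdistrib matrix_vector_right_distrib matrix_vector_mult_diff_distrib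
      vec_eq_iff algebra_simps)

text \<open>The matrix \<open>block_diag (mat 1) 0\<close> is the projection onto the first summand.\<close>
lemma block_diag_if_commute:
  fixes K :: "complex^('s::finite + 's)^('s + 's)"
  assumes "\<And>w. K *v (block_diag (mat 1) 0 *v w) = block_diag (mat 1) 0 *v (K *v w)"
  shows "\<exists>A B. K = block_diag A B"
proof -
  have "K ** block_diag (mat 1) 0 = block_diag (mat 1) 0 ** K"
    by (rule matrix_eq[THEN iffD2]) (simp add: matrix_vector_mul_assoc[symmetric] assms)
  then have eq: "(K ** block_diag (mat 1) 0) $ i $ j = (block_diag (mat 1) 0 ** K) $ i $ j" for i j
    by simp
  have 1: "K $ Inl i $ Inr j = 0" for i j
    using eq[of "Inl i" "Inr j"]
    by (simp add: matrix_matrix_mult_def sum_UNIV_sum_type block_diag_def mat_def if_distrib if_distribR cong: if_cong)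
  have 2: "K $ Inr i $ Inl j = 0" for i j
    using eq[of "Inr i" "Inl j"]
    by (simp add: matrix_matrix_mult_def sum_UNIV_sum_type block_diag_def mat_def if_distrib if_distribR cong: if_cong)
  have "K = block_diag (\<chi> i j. K $ Inl i $ Inl j) (\<chi> i j. K $ Inr i $ Inr j)"
    by (simp add: vec_pair_eq_iff block_diag_def 1 2)
  then show ?thesis by blast
qed

lemma block_diag_if_kernel_invariant:
  fixes K :: "complex^('s::finite + 's)^('s + 's)"
  assumes \<sigma>: "\<sigma> \<noteq> 0"
    and inv: "\<And>x1 x2 y1 y2. boundary_form \<sigma> K (vec_pair x1 x2) (vec_pair y1 y2) = 0 \<Longrightarrow>
      boundary_form \<sigma> K (vec_pair x1 0) (vec_pair y1 0) = 0"
  shows "\<exists>A B. K = block_diag A B"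
proof (rule block_diag_if_commute)
  fix w
  let ?P = "block_diag (mat 1) 0 :: complex^('s + 's)^('s + 's)"
  have P: "?P *v vec_pair u v = vec_pair u 0" for u v
    by (simp add: block_diag_mult_vec_pair)
  have invP: "boundary_form \<sigma> K (?P *v x) (?P *v y) = 0" if "boundary_form \<sigma> K x y = 0" for x y
    using vec_pair_components[of x] vec_pair_components[of y] that by (auto simp: P intro: inv)
  have "boundary_form \<sigma> K (?P *v (- \<sigma> *s ((K + mat 1) *v w))) (?P *v ((K - mat 1) *v w)) = 0"
    by (rule invP[OF boundary_form_kernel])
  then have "(2 * \<sigma>) *s (K *v (?P *v w) - ?P *v (K *v w)) = 0"
    by (simp add: boundary_form_def vector_scalar_commute matrix_vector_mult_minus_right matrix_vector_mult_diff_rdistrib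
      matrix_vector_mult_add_rdistrib matrix_vector_right_distrib matrix_vector_mult_diff_distrib
      vec_eq_iff algebra_simps) metis
  then have "K *v (?P *v w) - ?P *v (K *v w) = 0" using \<sigma> by (simp add: vec_eq_iff)
  then show "K *v (?P *v w) = ?P *v (K *v w)" by simp
qed

section \<open>Separated boundary conditions\<close>

lemma (in quasi_expression) separated_iff_block_diag:
  fixes K :: "complex^('s + 's)^('s + 's)"
  assumes \<sigma>: "\<sigma> \<noteq> 0"
  defines "L \<equiv> {(y, f) \<in> L_max a b p Q. boundary_form \<sigma> K (\<Gamma>\<^sub>1 a b p Q y) (\<Gamma>\<^sub>2 a b y) = 0}"
  shows "separated a b p Q L \<longleftrightarrow> (\<exists>A B. K = block_diag A B)"
proof
  have dom: "y \<in> Domain L \<longleftrightarrow> y \<in> Dom_max a b p Q \<and>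
      boundary_form \<sigma> K (vec_pair (D1 a b p Q y a) (- D1 a b p Q y b)) (vec_pair (y a) (y b)) = 0" for y
    by (auto simp: L_def L_max_def \<Gamma>\<^sub>1_def \<Gamma>\<^sub>2_def)
  have dom_max: "Domain (L_max a b p Q) = Dom_max a b p Q" by (auto simp: L_max_def)
  have ends: "a \<in> {a..b}" "b \<in> {a..b}" using ab by auto
  {
    assume sep: "separated a b p Q L"
    show "\<exists>A B. K = block_diag A B"
    proof (rule block_diag_if_kernel_invariant[OF \<sigma>])
      fix x1 x2 y1 y2 assume ker: "boundary_form \<sigma> K (vec_pair x1 x2) (vec_pair y1 y2) = 0"
      obtain y g h where y: "y \<in> Dom_max a b p Q" "g \<in> Dom_max a b p Q" "h \<in> Dom_max a b p Q"
        and germs: "same_germ a b a g y" "same_germ a b b g (\<lambda>_. 0)" "same_germ a b a h (\<lambda>_. 0)" "same_germ a b b h y"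
        and bv: "y a = y1" "D1 a b p Q y a = x1" "y b = y2" "D1 a b p Q y b = - x2"
        by (rule boundary_data_realized)
      have "y \<in> Domain L" using dom y(1) bv ker by simp
      then have "g \<in> Domain L" using sep y germs unfolding separated_def dom_max by blast
      then show "boundary_form \<sigma> K (vec_pair x1 0) (vec_pair y1 0) = 0"
        using same_germ_boundary_values(1)[OF y(1,2) ends(1) germs(1)]
          same_germ_boundary_values(2)[OF y(1,2) ends(2) germs(2)] bv by (simp add: dom)
    qed
  }
  assume "\<exists>A B. K = block_diag A B"
  then obtain A B where K: "K = block_diag A B" by blast
  show "separated a b p Q L"
    unfolding separated_def dom_max
  proof (intro ballI impI)
    fix y g h assume "y \<in> Domain L" and gh: "g \<in> Dom_max a b p Q" "h \<in> Dom_max a b p Q"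
      and germs: "same_germ a b a g y \<and> same_germ a b b g (\<lambda>_. 0) \<and> same_germ a b a h (\<lambda>_. 0) \<and> same_germ a b b h y"
    then have y: "y \<in> Dom_max a b p Q"
      and bc: "boundary_form \<sigma> K (vec_pair (D1 a b p Q y a) (- D1 a b p Q y b)) (vec_pair (y a) (y b)) = 0"
      by (simp_all add: dom)
    have g: "g a = y a \<and> D1 a b p Q g a = D1 a b p Q y a" "g b = 0 \<and> D1 a b p Q g b = 0"
      using same_germ_boundary_values[OF y gh(1)] ends germs by blast+
    have h: "h b = y b \<and> D1 a b p Q h b = D1 a b p Q y b" "h a = 0 \<and> D1 a b p Q h a = 0"
      using same_germ_boundary_values[OF y gh(2)] ends germs by blast+
    show "g \<in> Domain L \<and> h \<in> Domain L"
      using bc gh g h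
      by (simp add: dom K boundary_form_block_diag vec_pair_inject vec_pair_zero[symmetric])
  qed
qed

theorem theorem5:
  fixes a b :: real
    and p Q :: "real \<Rightarrow> complex^'s^'s"
    and K :: "complex^('s + 's)^('s + 's)"
  assumes "a < b"
    and "p \<in> borel_measurable (lebesgue_on {a<..<b})"
    and "Q \<in> borel_measurable (lebesgue_on {a<..<b})"
    and "\<forall>x\<in>{a<..<b}. hermitian (p x)"
    and "\<forall>x\<in>{a<..<b}. hermitian (Q x)"
    and "AE x in lebesgue_on {a<..<b}. invertible (p x)"
    and "integrable (lebesgue_on {a<..<b}) (\<lambda>x. matrix_inv (p x))"
    and "integrable (lebesgue_on {a<..<b}) (\<lambda>x. matrix_inv (p x) ** Q x)"
    and "integrable (lebesgue_on {a<..<b}) (\<lambda>x. Q x ** matrix_inv (p x))"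
    and "integrable (lebesgue_on {a<..<b}) (\<lambda>x. Q x ** matrix_inv (p x) ** Q x)"
  shows "(separated a b p Q (L_sub a b p Q K) \<longleftrightarrow> (\<exists>K\<^sub>a K\<^sub>b. K = block_diag K\<^sub>a K\<^sub>b)) \<and>
         (separated a b p Q (L_sup a b p Q K) \<longleftrightarrow> (\<exists>K\<^sub>a K\<^sub>b. K = block_diag K\<^sub>a K\<^sub>b))"
proof -
  interpret quasi_expression a b p Q
  proof
    show "coeffs p Q absolutely_integrable_on {a..b}"
      unfolding coeffs_def
      by (intro absolutely_integrable_Pair absolutely_integrable_on_open_interval assms)
  qed (use assms in auto)
  have sub: "L_sub a b p Q K =
      {(y, f) \<in> L_max a b p Q. boundary_form \<i> K (\<Gamma>\<^sub>1 a b p Q y) (\<Gamma>\<^sub>2 a b y) = 0}"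
    by (simp add: L_sub_def boundary_form_def)
  have "- \<i> *s v = - (\<i> *s v)" for v :: "complex^('s + 's)" by (simp add: vec_eq_iff)
  then have sup: "L_sup a b p Q K =
      {(y, f) \<in> L_max a b p Q. boundary_form (- \<i>) K (\<Gamma>\<^sub>1 a b p Q y) (\<Gamma>\<^sub>2 a b y) = 0}"
    by (simp add: L_sup_def boundary_form_def)
  show ?thesis
    unfolding sub sup
    using separated_iff_block_diag[of \<i> K] separated_iff_block_diag[of "- \<i>" K] by simp
qed

end
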